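(* Let $\Sigma$ be a finitely primitive Markov shift with alphabet $I\subset\mathbb{N}$ and left shift $\sigma$, let $G$ be a countable group, let $\Psi:I^{*}\to G$ be a semigroup homomorphism, and suppose that the group-extended Markov system $(\Sigma\times G,\sigma\rtimes\Psi)$ is topologically mixing. Let $\varphi:\Sigma\to\mathbb{R}$ be Hölder continuous with $\mathcal{P}(\varphi\circ\pi_1,\sigma\rtimes\Psi)<\infty$, and suppose that $\varphi\circ\pi_1$ is recurrent. Then $\varphi$ is symmetric on average with respect to $\Psi$ if and only if $\mathcal{P}(\varphi\circ\pi_1,\sigma\rtimes\Psi)=\mathcal{P}(\varphi,\sigma)$.
   Context: Markov shifts. For an at most countable alphabet $I$ and a matrix $A=(a(i,j))\in\{0,1\}^{I\times I}$, the Markov shift is $\Sigma=\{\omega\in I^{\mathbb{N}}: a(\omega_i,\omega_{i+1})=1\ \forall i\}$ with left shift $\sigma$; $\Sigma^n$ is the set of admissible words of length $n$ (words $\omega\in I^n$ with $a(\omega_i,\omega_{i+1})=1$ for $1\le i<n$), $\Sigma^*=\bigcup_{n\ge1}\Sigma^n$, and $[\omega]=\{\tau\in\Sigma:(\tau_1,\dots,\tau_n)=\omega\}$ for $\omega\in\Sigma^n$. $I^*$ is the free semigroup on $I$ (finite non-empty words under concatenation). $\Sigma$ is topologically mixing if for all $i,j\in I$ there is $n_0$ such that for every $n\ge n_0$ there is $\omega\in\Sigma^n$ with $i\omega j\in\Sigma^*$. $\Sigma$ is finitely primitive if there are $l\in\mathbb{N}$ and a finite set $\Lambda\subset\Sigma^l$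 such that for all $i,j\in I$ there is $\omega\in\Lambda$ with $i\omega j\in\Sigma^*$. Hölder continuity. $f:\Sigma\to\mathbb{R}$ is Hölder continuous if for some $\alpha>0$ there is a finite constant $V$ with $|f(\omega)-f(\tau)|\le V e^{-\alpha|\omega\wedge\tau|}$ for all $\omega,\tau\in\Sigma$ with $\omega_1=\tau_1$, where $|\omega\wedge\tau|$ is the length of the longest common initial block. $S_nf=\sum_{k=0}^{n-1}f\circ\sigma^k$. Group extension. $\sigma\rtimes\Psi:\Sigma\times G\to\Sigma\times G$, $(\sigma\rtimes\Psi)(\omega,g)=(\sigma\omega,g\Psi(\omega_1))$. It is identified with the Markov shift with alphabet $I\times G$ and state space $\{((\omega_j,g_j))_j\in(I\times G)^{\mathbb{N}}:\omega\in\Sigma,\ g_j\Psi(\omega_j)=g_{j+1}\ \forall j\}$; topological mixing, pressure and recurrence for $\Sigma\times G$ refer to this Markov shift. $\pi_1:\Sigma\times G\to\Sigma$ is the projection. Gurevich pressure and recurrence. For an irreducible Markov shift $(\Sigma,\sigma)$ (for all $i,j\in I$ there is $\omega\in\Sigma^*$ with $i\omega j\in\Sigma^*$) with alphabet $I$, Hölder continuous $f$ and $a\in I$, let $Z_n(f,a,\sigma)=\sum_{x\in\Sigma,\,x_1=a,\,\sigma^nx=x}e^{S_nf(x)}$ and $\mathcal{P}(f,\sigma)=\limsup_{n}\frac1n\log Z_n(f,a,\sigma)$ (independent of $a$). If $\mathcal{P}(f,\sigma)<\infty$, $f$ is recurrent if $\sum_{n}e^{-n\mathcal{P}(f,\sigma)}Z_n(f,a,\sigma)=\infty$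 for some (hence all) $a\in I$. Symmetric on average. With $P:=\mathcal{P}(\varphi\circ\pi_1,\sigma\rtimes\Psi)<\infty$, $\varphi$ is symmetric on average with respect to $\Psi$ if $$\sup_{g\in G}\ \limsup_{n\to\infty}\ \frac{\sum_{k=1}^{n}e^{-kP}\sum_{\omega\in\Sigma^{k}:\Psi(\omega)=g}e^{\sup S_k\varphi|_{[\omega]}}}{\sum_{k=1}^{n}e^{-kP}\sum_{\omega\in\Sigma^{k}:\Psi(\omega)=g^{-1}}e^{\sup S_k\varphi|_{[\omega]}}}<\infty .$$ *)

theory Defs
  imports "HOL-Analysis.Analysis" "HOL-Algebra.Group"
begin

section \<open>Markov shifts\<close>

text \<open>
  A Markov shift is given by its alphabet \<open>I\<close> and its transition matrix, represented as a
  relation \<open>A\<close> (with \<open>A i j\<close> meaning that the entry at \<open>(i, j)\<close> is 1), of which only the values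
  on \<open>I\<close> matter. Sequences are indexed from 0, so the first letter of \<open>x\<close> is \<open>x 0\<close>.
\<close>

definition markov_space :: "'a set \<Rightarrow> ('a \<Rightarrow> 'a \<Rightarrow> bool) \<Rightarrow> (nat \<Rightarrow> 'a) set" where
  "markov_space I A = {x. \<forall>i. x i \<in> I \<and> A (x i) (x (Suc i))}"

definition shift_map :: "(nat \<Rightarrow> 'a) \<Rightarrow> nat \<Rightarrow> 'a" where
  "shift_map x = (\<lambda>i. x (Suc i))"

definition adm_words_of_length :: "'a set \<Rightarrow> ('a \<Rightarrow> 'a \<Rightarrow> bool) \<Rightarrow> nat \<Rightarrow> 'a list set" where
  "adm_words_of_length I A n = {w. length w = n \<and> set w \<subseteq> I \<and> successively A w}"

definition adm_words :: "'a set \<Rightarrow> ('a \<Rightarrow> 'a \<Rightarrow> bool) \<Rightarrow> 'a list set" where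
  "adm_words I A = (\<Union>n\<in>{1..}. adm_words_of_length I A n)"

definition cylinder :: "'a set \<Rightarrow> ('a \<Rightarrow> 'a \<Rightarrow> bool) \<Rightarrow> 'a list \<Rightarrow> (nat \<Rightarrow> 'a) set" where
  "cylinder I A w = {x \<in> markov_space I A. map x [0..<length w] = w}"

definition topologically_mixing :: "'a set \<Rightarrow> ('a \<Rightarrow> 'a \<Rightarrow> bool) \<Rightarrow> bool" where
  "topologically_mixing I A \<longleftrightarrow>
     (\<forall>i\<in>I. \<forall>j\<in>I. \<exists>n0. \<forall>n\<ge>n0. \<exists>w\<in>adm_words_of_length I A n. i # w @ [j] \<in> adm_words I A)"

definition finitely_primitive :: "'a set \<Rightarrow> ('a \<Rightarrow> 'a \<Rightarrow> bool) \<Rightarrow> bool" where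
  "finitely_primitive I A \<longleftrightarrow>
     (\<exists>l\<ge>1. \<exists>L. finite L \<and> L \<subseteq> adm_words_of_length I A l \<and>
        (\<forall>i\<in>I. \<forall>j\<in>I. \<exists>w\<in>L. i # w @ [j] \<in> adm_words I A))"

text \<open>
  For \<open>x \<noteq> y\<close> the length of the longest common initial block is the least index at which they
  differ. For \<open>x = y\<close> that length is infinite and the estimate reads \<open>0 \<le> 0\<close>.
\<close>

definition hoelder_continuous ::
    "'a set \<Rightarrow> ('a \<Rightarrow> 'a \<Rightarrow> bool) \<Rightarrow> ((nat \<Rightarrow> 'a) \<Rightarrow> real) \<Rightarrow> bool" where
  "hoelder_continuous I A f \<longleftrightarrow>
     (\<exists>\<alpha>>0. \<exists>V. \<forall>x\<in>markov_space I A. \<forall>y\<in>markov_space I A. x 0 = y 0 \<and> x \<noteq> y \<longrightarrow>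
        \<bar>f x - f y\<bar> \<le> V * exp (- \<alpha> * real (LEAST n. x n \<noteq> y n)))"

definition birkhoff_sum :: "((nat \<Rightarrow> 'a) \<Rightarrow> real) \<Rightarrow> nat \<Rightarrow> (nat \<Rightarrow> 'a) \<Rightarrow> real" where
  "birkhoff_sum f n x = (\<Sum>k<n. f ((shift_map ^^ k) x))"

section \<open>Gurevich pressure and recurrence\<close>

text \<open>The alphabet may be infinite, so partition functions take values in \<open>[0, \<infinity>]\<close>.\<close>

definition partition_fun ::
    "'a set \<Rightarrow> ('a \<Rightarrow> 'a \<Rightarrow> bool) \<Rightarrow> ((nat \<Rightarrow> 'a) \<Rightarrow> real) \<Rightarrow> 'a \<Rightarrow> nat \<Rightarrow> ennreal" where
  "partition_fun I A f a n =
     (\<Sum>\<^sub>\<infinity>x\<in>{x \<in> markov_space I A. x 0 = a \<and> (shift_map ^^ n) x = x}.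
        ennreal (exp (birkhoff_sum f n x)))"

definition ennreal_ln :: "ennreal \<Rightarrow> ereal" where
  "ennreal_ln x = (if x = 0 then - \<infinity> else if x = \<infinity> then \<infinity> else ereal (ln (enn2real x)))"

text \<open>
  For an irreducible shift and Hoelder continuous \<open>f\<close> the upper limit below does not depend on the
  letter \<open>a \<in> I\<close>; an arbitrary one is chosen.
\<close>

definition gurevich_pressure ::
    "'a set \<Rightarrow> ('a \<Rightarrow> 'a \<Rightarrow> bool) \<Rightarrow> ((nat \<Rightarrow> 'a) \<Rightarrow> real) \<Rightarrow> ereal" where
  "gurevich_pressure I A f =
     (let a = (SOME a. a \<in> I)
      in limsup (\<lambda>n. ereal (1 / real n) * ennreal_ln (partition_fun I A f a n)))"

text \<open>
  The next notion is meant for finite pressure. The pressure of an irreducible shift with non-empty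
  alphabet is never \<open>-\<infinity>\<close> (there are periodic points), so \<open>real_of_ereal\<close> is harmless once the
  pressure is \<open>< \<infinity>\<close>.
\<close>

definition recurrent ::
    "'a set \<Rightarrow> ('a \<Rightarrow> 'a \<Rightarrow> bool) \<Rightarrow> ((nat \<Rightarrow> 'a) \<Rightarrow> real) \<Rightarrow> bool" where
  "recurrent I A f \<longleftrightarrow>
     (\<exists>a\<in>I. (\<Sum>\<^sub>\<infinity>n\<in>{1..}. ennreal (exp (- real n * real_of_ereal (gurevich_pressure I A f)))
               * partition_fun I A f a n) = \<infinity>)"

section \<open>Group extensions\<close>

text \<open>
  The free semigroup of finite non-empty words. The monoid record only supplies a carrier and a
  multiplication for \<^const>\<open>hom\<close>; its unit field is irrelevant (the empty word is not in the
  carrier).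
\<close>

definition free_semigroup :: "'a set \<Rightarrow> 'a list monoid" where
  "free_semigroup I = \<lparr>carrier = {w. w \<noteq> [] \<and> set w \<subseteq> I}, mult = (@), one = []\<rparr>"

definition skew_product ::
    "('g, 'm) monoid_scheme \<Rightarrow> ('a list \<Rightarrow> 'g) \<Rightarrow> (nat \<Rightarrow> 'a) \<times> 'g \<Rightarrow> (nat \<Rightarrow> 'a) \<times> 'g" where
  "skew_product G \<Psi> = (\<lambda>(x, g). (shift_map x, g \<otimes>\<^bsub>G\<^esub> \<Psi> [x 0]))"

text \<open>
  The skew product is identified with the Markov shift with the following alphabet and transition
  relation; the lemmas below give the conjugacy.
\<close>

definition ext_alphabet :: "'a set \<Rightarrow> ('g, 'm) monoid_scheme \<Rightarrow> ('a \<times> 'g) set" where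
  "ext_alphabet I G = I \<times> carrier G"

definition ext_trans ::
    "('a \<Rightarrow> 'a \<Rightarrow> bool) \<Rightarrow> ('g, 'm) monoid_scheme \<Rightarrow> ('a list \<Rightarrow> 'g) \<Rightarrow> 'a \<times> 'g \<Rightarrow> 'a \<times> 'g \<Rightarrow> bool" where
  "ext_trans A G \<Psi> = (\<lambda>(i, g) (j, h). A i j \<and> g \<otimes>\<^bsub>G\<^esub> \<Psi> [i] = h)"

text \<open>The projection to the base shift, read on the Markov shift of the extension.\<close>

definition proj1 :: "(nat \<Rightarrow> 'a \<times> 'g) \<Rightarrow> nat \<Rightarrow> 'a" where
  "proj1 x = (\<lambda>j. fst (x j))"

lemma markov_space_ext:
  "markov_space (ext_alphabet I G) (ext_trans A G \<Psi>) =
     {x. proj1 x \<in> markov_space I A \<and>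
         (\<forall>j. snd (x j) \<in> carrier G \<and> snd (x j) \<otimes>\<^bsub>G\<^esub> \<Psi> [fst (x j)] = snd (x (Suc j)))}"
  by (auto simp: markov_space_def ext_alphabet_def ext_trans_def proj1_def case_prod_beta mem_Times_iff)

lemma ext_conjugacy_bij:
  assumes "group G" and "\<Psi> \<in> hom (free_semigroup I) G"
  shows "bij_betw (\<lambda>x. (proj1 x, snd (x 0)))
           (markov_space (ext_alphabet I G) (ext_trans A G \<Psi>)) (markov_space I A \<times> carrier G)"
proof -
  interpret group G by fact
  let ?X = "markov_space (ext_alphabet I G) (ext_trans A G \<Psi>)"
  let ?h = "\<lambda>x. (proj1 x, snd (x 0))"
  have \<Psi>: "\<Psi> [i] \<in> carrier G" if "i \<in> I" for i
    using assms(2) that by (auto simp: hom_def free_semigroup_def)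
  have "inj_on ?h ?X"
  proof (rule inj_onI)
    fix x y assume x: "x \<in> ?X" and y: "y \<in> ?X" and eq: "?h x = ?h y"
    have fst: "fst (x j) = fst (y j)" for j
      using eq by (auto simp: proj1_def dest: fun_cong)
    have "snd (x j) = snd (y j)" for j
    proof (induction j)
      case (Suc j)
      then show ?case using x y fst[of j] by (auto simp: markov_space_ext) metis
    qed (use eq in auto)
    then show "x = y" using fst by (auto simp: prod_eq_iff fun_eq_iff)
  qed
  moreover have "(w, g) \<in> ?h ` ?X" if w: "w \<in> markov_space I A" and g: "g \<in> carrier G" for w g
  proof -
    define c where "c = rec_nat g (\<lambda>j h. h \<otimes>\<^bsub>G\<^esub> \<Psi> [w j])"
    have c: "c 0 = g" "c (Suc j) = c j \<otimes>\<^bsub>G\<^esub> \<Psi> [w j]" for j by (auto simp: c_def)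
    have "w j \<in> I" for j using w by (auto simp: markov_space_def)
    then have "c j \<in> carrier G" for j by (induction j) (use c g \<Psi> in auto)
    then have "(\<lambda>j. (w j, c j)) \<in> ?X" using c w by (auto simp: markov_space_ext proj1_def)
    moreover have "(w, g) = ?h (\<lambda>j. (w j, c j))" using c by (auto simp: proj1_def)
    ultimately show ?thesis by (intro image_eqI[where x = "\<lambda>j. (w j, c j)"])
  qed
  moreover have "?h ` ?X \<subseteq> markov_space I A \<times> carrier G"
    by (auto simp: markov_space_ext)
  ultimately show ?thesis by (auto simp: bij_betw_def)
qed

lemma ext_conjugacy_shift:
  assumes "x \<in> markov_space (ext_alphabet I G) (ext_trans A G \<Psi>)"
  shows "(proj1 (shift_map x), snd (shift_map x 0)) = skew_product G \<Psi> (proj1 x, snd (x 0))"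
  using assms by (auto simp: markov_space_ext skew_product_def shift_map_def proj1_def)

definition ext_pressure ::
    "'a set \<Rightarrow> ('a \<Rightarrow> 'a \<Rightarrow> bool) \<Rightarrow> ('g, 'm) monoid_scheme \<Rightarrow> ('a list \<Rightarrow> 'g) \<Rightarrow>
     ((nat \<Rightarrow> 'a) \<Rightarrow> real) \<Rightarrow> ereal" where
  "ext_pressure I A G \<Psi> \<phi> =
     gurevich_pressure (ext_alphabet I G) (ext_trans A G \<Psi>) (\<phi> \<circ> proj1)"

section \<open>Symmetry on average\<close>

text \<open>
  The sum over \<open>1 \<le> k \<le> n\<close> in the numerator (and, for the inverse of \<open>g\<close>, in the denominator).
  The real supremum is the intended one for words with non-empty cylinder and Hoelder \<open>\<phi>\<close>, since
  \<open>birkhoff_sum \<phi> k\<close> is then bounded on the cylinder; in a finitely primitive shift no cylinder of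
  an admissible word is empty.
\<close>

definition weighted_sum ::
    "'a set \<Rightarrow> ('a \<Rightarrow> 'a \<Rightarrow> bool) \<Rightarrow> ('a list \<Rightarrow> 'g) \<Rightarrow> ((nat \<Rightarrow> 'a) \<Rightarrow> real) \<Rightarrow>
     real \<Rightarrow> 'g \<Rightarrow> nat \<Rightarrow> ennreal" where
  "weighted_sum I A \<Psi> \<phi> P g n =
     (\<Sum>k=1..n. ennreal (exp (- real k * P)) *
        (\<Sum>\<^sub>\<infinity>w\<in>{w \<in> adm_words_of_length I A k. \<Psi> w = g}.
           ennreal (exp (SUP x\<in>cylinder I A w. birkhoff_sum \<phi> k x))))"

definition symmetric_on_average ::
    "'a set \<Rightarrow> ('a \<Rightarrow> 'a \<Rightarrow> bool) \<Rightarrow> ('g, 'm) monoid_scheme \<Rightarrow> ('a list \<Rightarrow> 'g) \<Rightarrow>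
     ((nat \<Rightarrow> 'a) \<Rightarrow> real) \<Rightarrow> bool" where
  "symmetric_on_average I A G \<Psi> \<phi> \<longleftrightarrow>
     (let P = real_of_ereal (ext_pressure I A G \<Psi> \<phi>)
      in (SUP g\<in>carrier G. limsup (\<lambda>n.
            weighted_sum I A \<Psi> \<phi> P g n / weighted_sum I A \<Psi> \<phi> P (inv\<^bsub>G\<^esub> g) n)) < \<infinity>)"

end

theory Submission
  imports Defs
begin

text \<open>
  Write \<open>P\<close> for the pressure of the extension and give a word \<open>w\<close> of length \<open>k\<close> the weight
  \<open>exp (sup S\<^sub>k \<phi> on [w] - k * P)\<close>. By bounded distortion this weight is multiplicative under
  concatenation up to a constant. The sums in the definition of symmetry on average are then the
  masses \<open>T g n\<close> of the words of length at most \<open>n\<close> with group value \<open>g\<close>, and they can be treated like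
  truncated Green functions of a random walk on the group, with words in place of random paths. Two
  properties of the weights replace independence. Weights are submultiplicative, so cutting a word at a
  given time gives upper bounds. Conversely, finite primitivity and mixing of the extension give for every \<open>g\<close> a fixed length such that
  any two words can be joined by a connecting word of that length and of value \<open>g\<close>, at the cost of a
  constant factor (lemmas \<open>gluing\<close> and \<open>gluing_mass\<close>); this gives lower bounds.

  Let \<open>F g\<close> be the mass of the words that take the value \<open>g\<close> for the first time at their end. Cutting at
  the first visit to \<open>g\<close>, and gluing a return behind a first visit, shows
  \<open>c * F g * T \<one> n \<le> T g n \<le> 2 * F g * T \<one> n\<close> for large \<open>n\<close> with \<open>c\<close> independent of \<open>g\<close>; here recurrence, that
  is \<open>T \<one> n \<longlonglongrightarrow> \<infinity>\<close>, makes bounded shifts of \<open>n\<close> harmless. Hence symmetry on average means that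
  \<open>F g\<close> is bounded by a constant multiple of \<open>F (inv g)\<close>, for all \<open>g\<close>. The substitute for \<open>returning with
  probability one\<close> is \<open>hit_mass_inverse\<close>: \<open>F g * F (inv g) \<ge> 1/4\<close>. It holds because the returns to \<open>\<one>\<close>
  that avoid \<open>g\<close> have finite mass, so that almost all of \<open>T \<one> n\<close> comes from words passing through \<open>g\<close>.

  If \<open>\<phi>\<close> is symmetric on average, these facts bound \<open>F\<close> from below, so every \<open>T g n\<close> is eventually at
  least \<open>T \<one> n\<close> times a constant that does not depend on \<open>g\<close>. Gluing behind an arbitrary word \<open>w\<close> of length \<open>n\<close> a word of value
  \<open>inv (gval w)\<close> produces returns to \<open>\<one>\<close>, and this forces the mass of all words of length \<open>n\<close> to be bounded in
  \<open>n\<close>: the pressure of \<open>\<phi>\<close> is at most \<open>P\<close>. If conversely the pressures agree, the mass of all words of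
  length \<open>n\<close> lies between \<open>1\<close> and a constant. First-visit words form a prefix-free set, so extending
  them to a common length gives distinct words, whence \<open>F\<close> is bounded above by a constant; together with
  \<open>F g * F (inv g) \<ge> 1/4\<close> it is bounded below as well, which is symmetry on average.
\<close>

section \<open>Sums of extended nonnegative reals\<close>

lemma infsum_ennreal_subset_mono:
  fixes f :: "'b \<Rightarrow> ennreal"
  assumes "X \<subseteq> Y"
  shows "infsum f X \<le> infsum f Y"
  using assms by (intro infsum_mono_neutral nonneg_summable_on_complete) auto

lemma infsum_ennreal_cmult:
  fixes f :: "'b \<Rightarrow> ennreal"
  shows "infsum (\<lambda>x. c * f x) X = c * infsum f X"
  by (simp add: nonneg_infsum_complete SUP_mult_left_ennreal[symmetric] sum_distrib_left[symmetric])

lemma sum_le_infsum_ennreal: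
  fixes f :: "'b \<Rightarrow> ennreal"
  assumes "finite F" "F \<subseteq> X"
  shows "sum f F \<le> infsum f X"
  using infsum_ennreal_subset_mono[OF assms(2), of f] assms(1) by simp

lemma infsum_ennreal_le:
  fixes f :: "'b \<Rightarrow> ennreal"
  assumes "\<And>F. finite F \<Longrightarrow> F \<subseteq> X \<Longrightarrow> sum f F \<le> b"
  shows "infsum f X \<le> b"
  using assms by (auto simp: nonneg_infsum_complete intro!: SUP_least)

text \<open>
  Masses of sets of words are mostly compared in this way: words are encoded injectively by
  words of another set (or by pairs of words) with control of the weights.
\<close>

lemma infsum_ennreal_inj_le:
  fixes f :: "'b \<Rightarrow> ennreal" and g :: "'c \<Rightarrow> ennreal"
  assumes "inj_on h X" "h ` X \<subseteq> Z" "\<And>x. x \<in> X \<Longrightarrow> f x \<le> g (h x)"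
  shows "infsum f X \<le> infsum g Z"
proof -
  have "infsum f X \<le> infsum (g \<circ> h) X"
    by (intro infsum_mono nonneg_summable_on_complete) (use assms(3) in auto)
  also have "\<dots> = infsum g (h ` X)"
    by (rule infsum_reindex[OF assms(1), symmetric])
  also have "\<dots> \<le> infsum g Z"
    by (rule infsum_ennreal_subset_mono[OF assms(2)])
  finally show ?thesis .
qed

lemma infsum_ennreal_Un_disjoint:
  fixes f :: "'b \<Rightarrow> ennreal"
  assumes "X \<inter> Y = {}"
  shows "infsum f (X \<union> Y) = infsum f X + infsum f Y"
  using assms by (intro infsum_Un_disjoint nonneg_summable_on_complete) auto

lemma infsum_ennreal_Un_le:
  fixes f :: "'b \<Rightarrow> ennreal"
  shows "infsum f (X \<union> Y) \<le> infsum f X + infsum f Y"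
proof -
  have "infsum f (X \<union> Y) = infsum f X + infsum f (Y - X)"
    using infsum_ennreal_Un_disjoint[of X "Y - X" f] by (simp add: Un_Diff_cancel)
  also have "\<dots> \<le> infsum f X + infsum f Y"
    by (intro add_left_mono infsum_ennreal_subset_mono) auto
  finally show ?thesis .
qed

lemma infsum_ennreal_Sigma_finite:
  fixes f :: "'b \<Rightarrow> 'c \<Rightarrow> ennreal"
  assumes "finite X"
  shows "infsum (\<lambda>(x, y). f x y) (Sigma X Y) = (\<Sum>x\<in>X. infsum (f x) (Y x))"
  using assms
proof (induction X rule: finite_induct)
  case (insert a X)
  have "Sigma (insert a X) Y = Pair a ` Y a \<union> Sigma X Y" by auto
  moreover have "Pair a ` Y a \<inter> Sigma X Y = {}" using insert.hyps by auto
  moreover have "infsum (\<lambda>(x, y). f x y) (Pair a ` Y a) = infsum (f a) (Y a)"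
    by (subst infsum_reindex) (auto simp: inj_on_def o_def)
  ultimately show ?case
    using insert by (simp add: infsum_ennreal_Un_disjoint)
qed simp

text \<open>
  Fubini for nonnegative terms. Every finite set of pairs lies over a finite set of first
  coordinates, so both inequalities reduce to the case of a finite base.
\<close>

lemma infsum_ennreal_Sigma:
  fixes f :: "'b \<Rightarrow> 'c \<Rightarrow> ennreal"
  shows "infsum (\<lambda>(x, y). f x y) (Sigma X Y) = infsum (\<lambda>x. infsum (f x) (Y x)) X"
proof (rule antisym)
  show "infsum (\<lambda>(x, y). f x y) (Sigma X Y) \<le> infsum (\<lambda>x. infsum (f x) (Y x)) X"
  proof (rule infsum_ennreal_le)
    fix F assume F: "finite F" "F \<subseteq> Sigma X Y"
    have "sum (\<lambda>(x, y). f x y) F \<le> infsum (\<lambda>(x, y). f x y) (Sigma (fst ` F) Y)"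
      using F by (intro sum_le_infsum_ennreal) force+
    also have "\<dots> = (\<Sum>x\<in>fst ` F. infsum (f x) (Y x))"
      using F by (intro infsum_ennreal_Sigma_finite) auto
    also have "\<dots> \<le> infsum (\<lambda>x. infsum (f x) (Y x)) X"
      using F by (intro sum_le_infsum_ennreal) auto
    finally show "sum (\<lambda>(x, y). f x y) F \<le> infsum (\<lambda>x. infsum (f x) (Y x)) X" .
  qed
  show "infsum (\<lambda>x. infsum (f x) (Y x)) X \<le> infsum (\<lambda>(x, y). f x y) (Sigma X Y)"
  proof (rule infsum_ennreal_le)
    fix F assume F: "finite F" "F \<subseteq> X"
    then have "(\<Sum>x\<in>F. infsum (f x) (Y x)) = infsum (\<lambda>(x, y). f x y) (Sigma F Y)"
      by (simp add: infsum_ennreal_Sigma_finite)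
    also have "\<dots> \<le> infsum (\<lambda>(x, y). f x y) (Sigma X Y)"
      using F by (intro infsum_ennreal_subset_mono) auto
    finally show "(\<Sum>x\<in>F. infsum (f x) (Y x)) \<le> infsum (\<lambda>(x, y). f x y) (Sigma X Y)" .
  qed
qed

lemma infsum_ennreal_product_Sigma:
  fixes f g :: "'b \<Rightarrow> ennreal"
  shows "infsum (\<lambda>(x, y). f x * g y) (Sigma X Y) = infsum (\<lambda>x. f x * infsum g (Y x)) X"
  by (simp add: infsum_ennreal_Sigma infsum_ennreal_cmult)

section \<open>Birkhoff sums and cylinders\<close>

lemma shift_map_power: "(shift_map ^^ n) x = (\<lambda>i. x (n + i))"
  by (induction n arbitrary: x) (auto simp: shift_map_def fun_eq_iff)

lemma birkhoff_sum_add: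
  "birkhoff_sum f (m + n) x = birkhoff_sum f m x + birkhoff_sum f n ((shift_map ^^ m) x)"
proof (induction n)
  case (Suc n)
  then show ?case by (simp add: birkhoff_sum_def shift_map_power add.assoc)
qed (simp add: birkhoff_sum_def)

lemma shift_power_in_markov_space:
  "x \<in> markov_space I A \<Longrightarrow> (shift_map ^^ n) x \<in> markov_space I A"
  by (auto simp: markov_space_def shift_map_power)

lemma in_cylinder_iff:
  "x \<in> cylinder I A w \<longleftrightarrow> x \<in> markov_space I A \<and> (\<forall>i<length w. x i = w ! i)"
proof -
  have "map x [0..<length w] = w \<longleftrightarrow> (\<forall>i<length w. x i = w ! i)"
    by (subst list_eq_iff_nth_eq) simp
  then show ?thesis by (simp add: cylinder_def)
qed

lemma cylinder_appendD:
  assumes "x \<in> cylinder I A (u @ v)"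
  shows "x \<in> cylinder I A u" "(shift_map ^^ length u) x \<in> cylinder I A v"
proof -
  show "x \<in> cylinder I A u"
    using assms by (auto simp: in_cylinder_iff nth_append)
  have "x (length u + i) = v ! i" if "i < length v" for i
    using assms that by (auto simp: in_cylinder_iff dest!: spec[of _ "length u + i"])
  then show "(shift_map ^^ length u) x \<in> cylinder I A v"
    using assms shift_power_in_markov_space[of x I A] by (auto simp: in_cylinder_iff shift_map_power)
qed

lemma successively_conv_nth:
  "successively P w \<longleftrightarrow> (\<forall>i. Suc i < length w \<longrightarrow> P (w ! i) (w ! Suc i))"
proof (induction P w rule: successively.induct)
  case (3 P x y xs)
  then show ?case
    by (auto simp: nth_Cons' gr0_conv_Suc) (metis Suc_pred gr0_conv_Suc less_Suc_eq_0_disj not_less_eq)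
qed auto

text \<open>
  Unlike the words of the Markov shift, admissible words here may be empty: prefixes and remainders of a cut
  word are then always admissible.
\<close>

definition admissible :: "'a set \<Rightarrow> ('a \<Rightarrow> 'a \<Rightarrow> bool) \<Rightarrow> 'a list \<Rightarrow> bool" where
  "admissible I A w \<longleftrightarrow> set w \<subseteq> I \<and> successively A w"

lemma adm_words_of_length_iff: "w \<in> adm_words_of_length I A n \<longleftrightarrow> length w = n \<and> admissible I A w"
  by (auto simp: adm_words_of_length_def admissible_def)

lemma adm_words_iff: "w \<in> adm_words I A \<longleftrightarrow> w \<noteq> [] \<and> admissible I A w"
  by (cases w) (auto simp: adm_words_def adm_words_of_length_iff)

lemma admissible_append:
  "admissible I A (u @ v) \<longleftrightarrow> admissible I A u \<and> admissible I A v \<and>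
     (u \<noteq> [] \<longrightarrow> v \<noteq> [] \<longrightarrow> A (last u) (hd v))"
  by (auto simp: admissible_def successively_append_iff)

lemma admissible_Nil [simp]: "admissible I A []"
  by (simp add: admissible_def)

lemma admissible_single [simp]: "admissible I A [a] \<longleftrightarrow> a \<in> I"
  by (simp add: admissible_def)

lemma admissible_initial_block:
  assumes "x \<in> markov_space I A"
  shows "admissible I A (map x [0..<n])"
  using assms by (auto simp: admissible_def successively_conv_nth markov_space_def)

text \<open>
  An admissible word is continued to a point of the shift by iterating a choice of successors from its
  last letter on.
\<close>

lemma cylinder_nonempty:
  assumes succ: "\<And>i. i \<in> I \<Longrightarrow> \<exists>j\<in>I. A i j" and "I \<noteq> {}" and w: "admissible I A w"
  shows "cylinder I A w \<noteq> {}"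
proof -
  have nonempty: "cylinder I A w \<noteq> {}" if w: "admissible I A w" "w \<noteq> []" for w
  proof -
    obtain s where s: "\<And>i. i \<in> I \<Longrightarrow> s i \<in> I \<and> A i (s i)" using succ by metis
    define x where "x = (\<lambda>n. if n < length w then w ! n else (s ^^ (n + 1 - length w)) (last w))"
    have last: "last w \<in> I" using w by (auto simp: admissible_def)
    have it: "(s ^^ k) (last w) \<in> I" for k by (induction k) (use s last in auto)
    have "x n \<in> I" for n using w it by (auto simp: x_def admissible_def)
    moreover have "A (x n) (x (Suc n))" for n
    proof -
      consider "Suc n < length w" | "Suc n = length w" | "length w \<le> n" by linarith
      then show ?thesis
      proof cases
        case 1
        then show ?thesis using w
          by (auto simp: x_def admissible_def successively_conv_nth)
      next
        case 2
        then have "w ! n = last w" using w by (metis diff_Suc_1 last_conv_nth)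
        then show ?thesis using 2 s last by (auto simp: x_def)
      next
        case 3
        then have "Suc n + 1 - length w = Suc (n + 1 - length w)" by simp
        then show ?thesis using 3 s it by (auto simp: x_def)
      qed
    qed
    ultimately have "x \<in> cylinder I A w" by (auto simp: in_cylinder_iff markov_space_def x_def)
    then show ?thesis by blast
  qed
  obtain a where "a \<in> I" using \<open>I \<noteq> {}\<close> by blast
  show ?thesis
  proof (cases "w = []")
    case True
    then show ?thesis using nonempty[of "[a]"] \<open>a \<in> I\<close> by (auto simp: in_cylinder_iff)
  qed (use nonempty w in blast)
qed

text \<open>
  Two points of a cylinder of length \<open>n\<close> have \<open>k\<close>-th iterates that agree in \<open>n - k\<close> places, so the
  differences of \<open>f\<close> along the orbits are dominated by a geometric series, uniformly in \<open>n\<close>.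
\<close>

lemma hoelder_bounded_distortion:
  assumes "hoelder_continuous I A f"
  shows "\<exists>D\<ge>0. \<forall>w. \<forall>x\<in>cylinder I A w. \<forall>y\<in>cylinder I A w.
           birkhoff_sum f (length w) x \<le> birkhoff_sum f (length w) y + D"
proof -
  obtain \<alpha> V where "\<alpha> > 0" and V: "\<And>x y. x \<in> markov_space I A \<Longrightarrow> y \<in> markov_space I A \<Longrightarrow>
      x 0 = y 0 \<Longrightarrow> x \<noteq> y \<Longrightarrow> \<bar>f x - f y\<bar> \<le> V * exp (- \<alpha> * real (LEAST n. x n \<noteq> y n))"
    using assms unfolding hoelder_continuous_def by blast
  \<comment> \<open>Hoelder continuity reads: points agreeing in \<open>n > 0\<close> places have values within \<open>\<bar>V\<bar> * r ^ n\<close>.\<close>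
  define r where "r = exp (- \<alpha>)"
  have r: "0 < r" "r < 1" using \<open>\<alpha> > 0\<close> by (auto simp: r_def)
  have close: "f x \<le> f y + \<bar>V\<bar> * r ^ n"
    if x: "x \<in> markov_space I A" and y: "y \<in> markov_space I A"
      and eq: "\<And>i. i < n \<Longrightarrow> x i = y i" and n: "n > 0" for x y n
  proof (cases "x = y")
    case False
    then obtain i where "x i \<noteq> y i" by auto
    then have "x (LEAST n. x n \<noteq> y n) \<noteq> y (LEAST n. x n \<noteq> y n)" by (rule LeastI)
    then have least: "n \<le> (LEAST n. x n \<noteq> y n)" using eq not_less by blast
    have "f x - f y \<le> \<bar>V\<bar> * exp (- \<alpha> * real (LEAST n. x n \<noteq> y n))"
      using V[OF x y _ False] eq n
      by (smt (verit) exp_gt_zero mult_right_mono)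
    also have "\<dots> \<le> \<bar>V\<bar> * exp (- \<alpha> * real n)"
      using least \<open>\<alpha> > 0\<close> by (intro mult_left_mono) auto
    also have "exp (- \<alpha> * real n) = r ^ n"
      by (simp add: r_def exp_of_nat_mult[symmetric] mult.commute)
    finally show ?thesis by simp
  qed (use r in auto)
  have "birkhoff_sum f (length w) x \<le> birkhoff_sum f (length w) y + \<bar>V\<bar> * (1 / (1 - r))"
    if x: "x \<in> cylinder I A w" and y: "y \<in> cylinder I A w" for w x y
  proof -
    let ?n = "length w"
    have "birkhoff_sum f ?n x \<le>
        (\<Sum>k<?n. f ((shift_map ^^ k) y) + \<bar>V\<bar> * r ^ (?n - k))"
      unfolding birkhoff_sum_def
    proof (rule sum_mono)
      fix k assume "k \<in> {..<?n}"
      then show "f ((shift_map ^^ k) x) \<le> f ((shift_map ^^ k) y) + \<bar>V\<bar> * r ^ (?n - k)"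
        using x y by (intro close shift_power_in_markov_space)
          (auto simp: in_cylinder_iff shift_map_power)
    qed
    also have "\<dots> = birkhoff_sum f ?n y + \<bar>V\<bar> * (\<Sum>k<?n. r ^ (?n - k))"
      by (simp add: birkhoff_sum_def sum.distrib sum_distrib_left)
    also have "(\<Sum>k<?n. r ^ (?n - k)) = (\<Sum>k<?n. r ^ Suc k)"
      by (rule sum.reindex_bij_witness[of _ "\<lambda>k. ?n - 1 - k" "\<lambda>k. ?n - 1 - k"])
        (auto simp: Suc_diff_Suc simp del: power_Suc)
    also have "\<dots> \<le> (\<Sum>k<?n. r ^ k)"
      using r by (intro sum_mono) (auto simp: mult_le_cancel_right1)
    also have "\<dots> \<le> 1 / (1 - r)"
    proof -
      have "(\<Sum>k<?n. r ^ k) = (1 - r ^ ?n) / (1 - r)" using r by (simp add: sum_gp_strict)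
      then show ?thesis using r by (simp add: divide_right_mono)
    qed
    finally show ?thesis by (simp add: mult_left_mono)
  qed
  then show ?thesis using r by (intro exI[of _ "\<bar>V\<bar> * (1 / (1 - r))"]) auto
qed

section \<open>Exponential growth rates\<close>

definition growth_rate :: "(nat \<Rightarrow> ennreal) \<Rightarrow> ereal" where
  "growth_rate Z = limsup (\<lambda>n. ereal (1 / real n) * ennreal_ln (Z n))"

lemma ennreal_ln_le:
  assumes "Z \<le> ennreal r" "r > 0"
  shows "ennreal_ln Z \<le> ereal (ln r)"
proof -
  have "Z \<noteq> \<infinity>" using assms by (auto simp: top_unique)
  moreover have "ln (enn2real Z) \<le> ln r" if "Z \<noteq> 0"
  proof -
    have "Z < \<infinity>" using \<open>Z \<noteq> \<infinity>\<close> by (simp add: less_top)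
    then have "0 < enn2real Z" using that by (simp add: enn2real_positive_iff zero_less_iff_neq_zero)
    moreover have "enn2real Z \<le> r" using assms by (intro enn2real_leI) auto
    ultimately show ?thesis by simp
  qed
  ultimately show ?thesis by (auto simp: ennreal_ln_def)
qed

lemma ennreal_ln_ge:
  assumes "ennreal r \<le> Z" "r > 0"
  shows "ereal (ln r) \<le> ennreal_ln Z"
proof (cases "Z = \<infinity>")
  case False
  then have "Z < \<infinity>" by (simp add: less_top)
  then have "r \<le> enn2real Z" using assms enn2real_mono[of "ennreal r" Z] by simp
  moreover have "Z \<noteq> 0" using assms by (auto simp: ennreal_eq_0_iff)
  ultimately show ?thesis using assms False by (simp add: ennreal_ln_def)
qed (simp add: ennreal_ln_def)

lemma growth_rate_le:
  assumes "\<And>n. n \<ge> 1 \<Longrightarrow> Z n \<le> ennreal (C * exp (real n * P))" and C: "C > 0"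
  shows "growth_rate Z \<le> ereal P"
proof -
  have "eventually (\<lambda>n. ereal (1 / real n) * ennreal_ln (Z n) \<le> ereal (ln C / real n + P)) sequentially"
    using eventually_ge_at_top[of 1]
  proof eventually_elim
    case (elim n)
    have "ennreal_ln (Z n) \<le> ereal (ln C + real n * P)"
      using ennreal_ln_le[OF assms(1)[OF elim]] C by (simp add: ln_mult)
    then have "ereal (1 / real n) * ennreal_ln (Z n) \<le> ereal (1 / real n) * ereal (ln C + real n * P)"
      by (intro ereal_mult_left_mono) auto
    then show ?case using elim by (simp add: field_simps)
  qed
  then have "growth_rate Z \<le> limsup (\<lambda>n. ereal (ln C / real n + P))"
    unfolding growth_rate_def by (rule Limsup_mono)
  also have "(\<lambda>n. ln C / real n + P) \<longlonglongrightarrow> 0 + P"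
    by (intro tendsto_add tendsto_const tendsto_divide_0[OF tendsto_const] filterlim_at_top_imp_at_infinity
        filterlim_real_sequentially)
  then have "limsup (\<lambda>n. ereal (ln C / real n + P)) = ereal P"
    by (intro lim_imp_Limsup) auto
  finally show ?thesis .
qed

text \<open>
  Exponential growth at a rate larger than \<open>P\<close> along the multiples of a fixed \<open>n\<close> suffices, because the
  growth rate is an upper limit.
\<close>

lemma growth_rate_gt:
  assumes grow: "\<And>k. k \<ge> 1 \<Longrightarrow> ennreal (\<theta> ^ k * exp (real (k * n) * P)) \<le> Z (k * n)"
    and "\<theta> > 1" "n \<ge> 1"
  shows "ereal P < growth_rate Z"
proof -
  have le: "ereal (P + ln \<theta> / real n) \<le> ereal (1 / real (k * n)) * ennreal_ln (Z (k * n))" if "k \<ge> 1" for k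
  proof -
    have "ereal (real k * ln \<theta> + real (k * n) * P) \<le> ennreal_ln (Z (k * n))"
      using ennreal_ln_ge[OF grow[OF that]] \<open>\<theta> > 1\<close> by (simp add: ln_mult ln_realpow)
    then have "ereal (1 / real (k * n)) * ereal (real k * ln \<theta> + real (k * n) * P) \<le>
        ereal (1 / real (k * n)) * ennreal_ln (Z (k * n))"
      by (intro ereal_mult_left_mono) auto
    moreover have "1 / real (k * n) * (real k * ln \<theta> + real (k * n) * P) = P + ln \<theta> / real n"
      using that \<open>n \<ge> 1\<close> by (simp add: field_simps)
    ultimately show ?thesis by (simp only: times_ereal.simps)
  qed
  have "ereal (P + ln \<theta> / real n) \<le> growth_rate Z"
    unfolding growth_rate_def limsup_INF_SUP
  proof (rule INF_greatest)
    fix N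
    have "Suc N * n \<in> {N..}" using \<open>n \<ge> 1\<close> by (simp add: add_increasing)
    then show "ereal (P + ln \<theta> / real n) \<le> (SUP m\<in>{N..}. ereal (1 / real m) * ennreal_ln (Z m))"
      using le[of "Suc N"] by (intro SUP_upper2[of "Suc N * n"]) auto
  qed
  moreover have "P < P + ln \<theta> / real n" using \<open>\<theta> > 1\<close> \<open>n \<ge> 1\<close> by simp
  ultimately show ?thesis by (meson ereal_less_eq(3) less_ereal.simps(1) order_less_le_trans)
qed

section \<open>Words and their group values\<close>

text \<open>
  Hoelder continuity is replaced by its consequence used throughout, bounded distortion with constant \<open>D\<close>.
  The number \<open>P\<close> normalises the weights of words. It is not tied to a pressure yet, so that the results
  can be used for all values of \<open>P\<close> at once when two pressures are compared.
\<close>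

locale group_extended_shift = group G for G :: "('g, 'm) monoid_scheme" (structure) +
  fixes I :: "'a set" and A :: "'a \<Rightarrow> 'a \<Rightarrow> bool" and \<Psi> :: "'a list \<Rightarrow> 'g"
    and \<phi> :: "(nat \<Rightarrow> 'a) \<Rightarrow> real" and D P :: real
  assumes alphabet_nonempty: "I \<noteq> {}"
    and finitely_primitive: "finitely_primitive I A"
    and hom: "\<Psi> \<in> hom (free_semigroup I) G"
    and mixing: "topologically_mixing (ext_alphabet I G) (ext_trans A G \<Psi>)"
    and D_nonneg: "0 \<le> D"
    and distortion: "\<And>w x y. x \<in> cylinder I A w \<Longrightarrow> y \<in> cylinder I A w \<Longrightarrow>
      birkhoff_sum \<phi> (length w) x \<le> birkhoff_sum \<phi> (length w) y + D"
begin

abbreviation adm :: "'a list \<Rightarrow> bool" where "adm \<equiv> admissible I A"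

text \<open>
  The homomorphism \<open>\<Psi>\<close>, extended by \<open>\<one>\<close> to the empty word, where \<open>\<Psi>\<close> itself is arbitrary.
\<close>

definition gval :: "'a list \<Rightarrow> 'g" where
  "gval w = foldr (\<lambda>i g. \<Psi> [i] \<otimes> g) w \<one>"

lemma Psi_letter [simp]: "i \<in> I \<Longrightarrow> \<Psi> [i] \<in> carrier G"
  using hom by (auto simp: hom_def free_semigroup_def)

lemma gval_Nil [simp]: "gval [] = \<one>"
  by (simp add: gval_def)

lemma gval_Cons [simp]: "gval (i # w) = \<Psi> [i] \<otimes> gval w"
  by (simp add: gval_def)

lemma gval_closed [simp]: "set w \<subseteq> I \<Longrightarrow> gval w \<in> carrier G"
  by (induction w) auto

lemma gval_append: "set u \<subseteq> I \<Longrightarrow> set v \<subseteq> I \<Longrightarrow> gval (u @ v) = gval u \<otimes> gval v"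
  by (induction u) (auto simp: m_assoc)

lemma Psi_eq_gval: "w \<noteq> [] \<Longrightarrow> set w \<subseteq> I \<Longrightarrow> \<Psi> w = gval w"
proof (induction w)
  case (Cons i w)
  show ?case
  proof (cases "w = []")
    case False
    then have "\<Psi> ([i] @ w) = \<Psi> [i] \<otimes> \<Psi> w"
      using hom_mult[OF hom, of "[i]" w] Cons.prems False by (simp add: free_semigroup_def)
    then show ?thesis using Cons False by simp
  qed (use Cons in auto)
qed simp

lemma adm_set: "adm w \<Longrightarrow> set w \<subseteq> I"
  by (simp add: admissible_def)

lemma gval_adm_append: "adm (u @ v) \<Longrightarrow> gval (u @ v) = gval u \<otimes> gval v"
  by (auto simp: admissible_append adm_set gval_append)

lemma gval_adm_closed: "adm w \<Longrightarrow> gval w \<in> carrier G"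
  by (simp add: adm_set)

text \<open>
  Admissibility only concerns adjacent letters, so words may be pasted along a common letter.
\<close>

lemma adm_overlap: "adm (u @ [a]) \<Longrightarrow> adm (a # v) \<Longrightarrow> adm (u @ a # v)"
  by (auto simp: admissible_append)

lemma letter_has_successor: "i \<in> I \<Longrightarrow> \<exists>j\<in>I. A i j"
proof -
  assume i: "i \<in> I"
  obtain w where w: "adm (i # w @ [i])"
    using finitely_primitive i unfolding finitely_primitive_def adm_words_iff by meson
  then have "A i (hd (w @ [i]))" by (auto simp: admissible_def successively_Cons)
  moreover have "hd (w @ [i]) \<in> I" using adm_set[OF w] by (cases w) auto
  ultimately show ?thesis by blast
qed

lemma adm_cylinder_nonempty: "adm w \<Longrightarrow> cylinder I A w \<noteq> {}"
  using cylinder_nonempty[OF letter_has_successor alphabet_nonempty] .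

section \<open>The weight of a word\<close>

definition wt :: "'a list \<Rightarrow> real" where
  "wt w = exp ((SUP x\<in>cylinder I A w. birkhoff_sum \<phi> (length w) x) - real (length w) * P)"

definition mass :: "'a list set \<Rightarrow> ennreal" where
  "mass X = (\<Sum>\<^sub>\<infinity>w\<in>X. ennreal (wt w))"

lemma wt_pos [simp]: "0 < wt w" "0 \<le> wt w"
  by (simp_all add: wt_def)

lemma mass_mono: "X \<subseteq> Y \<Longrightarrow> mass X \<le> mass Y"
  unfolding mass_def by (rule infsum_ennreal_subset_mono)

lemma birkhoff_bdd_above: "bdd_above (birkhoff_sum \<phi> (length w) ` cylinder I A w)"
proof (cases "cylinder I A w = {}")
  case False
  then obtain y where "y \<in> cylinder I A w" by blast
  then show ?thesis using distortion by (intro bdd_aboveI2) blast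
qed simp

lemma wt_ge:
  assumes "x \<in> cylinder I A w"
  shows "exp (birkhoff_sum \<phi> (length w) x - real (length w) * P) \<le> wt w"
  unfolding wt_def using assms birkhoff_bdd_above by (auto intro!: cSUP_upper)

lemma wt_le:
  assumes "x \<in> cylinder I A w"
  shows "wt w \<le> exp D * exp (birkhoff_sum \<phi> (length w) x - real (length w) * P)"
proof -
  have "(SUP x\<in>cylinder I A w. birkhoff_sum \<phi> (length w) x) \<le> birkhoff_sum \<phi> (length w) x + D"
    using assms distortion by (intro cSUP_least) auto
  then show ?thesis unfolding wt_def exp_add[symmetric] by simp
qed

lemma wt_Nil [simp]: "wt [] = 1"
proof -
  have "cylinder I A [] \<noteq> {}" by (rule adm_cylinder_nonempty) simp
  then show ?thesis by (simp add: wt_def birkhoff_sum_def)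
qed

lemma wt_append_le:
  assumes "adm (u @ v)"
  shows "wt (u @ v) \<le> wt u * wt v"
proof -
  let ?S = "\<lambda>w. birkhoff_sum \<phi> (length w)"
  have "?S (u @ v) x \<le> Sup (?S u ` cylinder I A u) + Sup (?S v ` cylinder I A v)"
    if x: "x \<in> cylinder I A (u @ v)" for x
    unfolding length_append birkhoff_sum_add using cylinder_appendD[OF x]
    by (intro add_mono cSUP_upper birkhoff_bdd_above)
  then have "Sup (?S (u @ v) ` cylinder I A (u @ v)) \<le>
      Sup (?S u ` cylinder I A u) + Sup (?S v ` cylinder I A v)"
    using adm_cylinder_nonempty[OF assms] by (intro cSUP_least) auto
  then show ?thesis unfolding wt_def exp_add[symmetric] by (simp add: algebra_simps)
qed

text \<open>
  Up to the distortion constant, both weights are given by the orbit of a single point of \<open>[u @ v]\<close>, along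
  which Birkhoff sums are additive.
\<close>

lemma wt_append_ge:
  assumes "adm (u @ v)"
  shows "exp (- 2 * D) * wt u * wt v \<le> wt (u @ v)"
proof -
  obtain x where x: "x \<in> cylinder I A (u @ v)" using adm_cylinder_nonempty[OF assms] by blast
  let ?S = "\<lambda>w x. birkhoff_sum \<phi> (length w) x - real (length w) * P"
  let ?y = "(shift_map ^^ length u) x"
  have "wt u * wt v \<le> (exp D * exp (?S u x)) * (exp D * exp (?S v ?y))"
    using cylinder_appendD[OF x] by (intro mult_mono wt_le) auto
  also have "\<dots> = exp (2 * D) * exp (?S (u @ v) x)"
    unfolding exp_add[symmetric] by (simp add: birkhoff_sum_add algebra_simps)
  also have "\<dots> \<le> exp (2 * D) * wt (u @ v)"
    using wt_ge[OF x] by simp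
  finally have "exp (- 2 * D) * (wt u * wt v) \<le> exp (- 2 * D) * (exp (2 * D) * wt (u @ v))"
    by (intro mult_left_mono) auto
  then show ?thesis by (simp add: mult.assoc[symmetric] exp_add[symmetric])
qed

section \<open>Gluing words with a prescribed group element\<close>

text \<open>
  A path in the extension is a path of the base whose group value moves the first group coordinate to
  the last; this turns mixing of the extension into the existence of base words of given value.
\<close>

lemma ext_path_value:
  assumes "successively (ext_trans A G \<Psi>) ((i, g) # w @ [(j, h)])" "g \<in> carrier G" "i \<in> I"
    "fst ` set w \<subseteq> I"
  shows "h = g \<otimes> gval (i # map fst w) \<and> successively A (i # map fst w @ [j])"
  using assms
proof (induction w arbitrary: i g)
  case (Cons a w)
  obtain i' g' where a: "a = (i', g')" by fastforce
  have i': "i' \<in> I" "A i i'" "g' = g \<otimes> \<Psi> [i]" and *: "fst ` set w \<subseteq> I"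
    "successively (ext_trans A G \<Psi>) ((i', g') # w @ [(j, h)])" "g' \<in> carrier G"
    using Cons.prems a by (auto simp: ext_trans_def)
  have "h = g' \<otimes> gval (i' # map fst w) \<and> successively A (i' # map fst w @ [j])"
    by (rule Cons.IH) (use * i' in auto)
  moreover have "gval (map fst w) \<in> carrier G" using *(1) by (intro gval_closed) auto
  ultimately show ?case using i' a Cons.prems * by (auto simp: m_assoc)
qed (auto simp: ext_trans_def)

text \<open>
  Since mixing supplies paths of all large lengths, finitely many values can be realised by loops of
  one common length.
\<close>

lemma loops_with_value:
  assumes a: "a \<in> I" and "finite H" "H \<subseteq> carrier G"
  shows "\<exists>n. \<forall>h\<in>H. \<exists>q. length q = n \<and> adm (a # q @ [a]) \<and> gval (a # q) = h"
proof -
  have "\<exists>N. \<forall>n\<ge>N. \<exists>q. length q = n \<and> adm (a # q @ [a]) \<and> gval (a # q) = h" if h: "h \<in> H" for h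
  proof -
    have *: "(a, \<one>) \<in> ext_alphabet I G" "(a, h) \<in> ext_alphabet I G"
      using a h assms(3) by (auto simp: ext_alphabet_def)
    obtain N where N: "\<And>n. n \<ge> N \<Longrightarrow> \<exists>w\<in>adm_words_of_length (ext_alphabet I G) (ext_trans A G \<Psi>) n.
        (a, \<one>) # w @ [(a, h)] \<in> adm_words (ext_alphabet I G) (ext_trans A G \<Psi>)"
      using mixing * unfolding topologically_mixing_def by blast
    have "\<exists>q. length q = n \<and> adm (a # q @ [a]) \<and> gval (a # q) = h" if n: "n \<ge> N" for n
    proof -
      obtain w where w: "length w = n" "set w \<subseteq> I \<times> carrier G"
        "successively (ext_trans A G \<Psi>) ((a, \<one>) # w @ [(a, h)])"
        using N[OF n] by (auto simp: adm_words_iff admissible_def ext_alphabet_def adm_words_of_length_iff)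
      have sub: "fst ` set w \<subseteq> I" using w(2) by auto
      have "h = \<one> \<otimes> gval (a # map fst w) \<and> successively A (a # map fst w @ [a])"
        by (rule ext_path_value[OF w(3)]) (use a sub in auto)
      moreover have "gval (a # map fst w) \<in> carrier G" using a sub by (intro gval_closed) auto
      ultimately show ?thesis using w(1) sub a
        by (intro exI[of _ "map fst w"]) (auto simp: admissible_def)
    qed
    then show ?thesis by blast
  qed
  then obtain N where N: "\<And>h n. h \<in> H \<Longrightarrow> n \<ge> N h \<Longrightarrow>
      \<exists>q. length q = n \<and> adm (a # q @ [a]) \<and> gval (a # q) = h" by metis
  have "N h \<le> Max (N ` H)" if "h \<in> H" for h using that \<open>finite H\<close> by auto
  then show ?thesis using N by blast
qed

text \<open>
  From \<open>i\<close> one reaches a base letter \<open>a\<close> by one of finitely many words \<open>u\<close>, and from \<open>a\<close> one reaches \<open>j\<close>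
  by one of finitely many words \<open>v\<close>. A loop at \<open>a\<close> in between, chosen for each pair \<open>(u, v)\<close>, corrects the
  group value to \<open>g\<close>; finitely many corrections are needed, so a common length is available.
\<close>

lemma connecting_words:
  assumes g: "g \<in> carrier G"
  shows "\<exists>l\<ge>1. \<exists>L. finite L \<and> (\<forall>i\<in>I. \<forall>j\<in>I. \<exists>u\<in>L. length u = l \<and> gval u = g \<and> adm (i # u @ [j]))"
proof -
  obtain l L where "l \<ge> 1" and L: "finite L" "L \<subseteq> adm_words_of_length I A l"
      "\<And>i j. i \<in> I \<Longrightarrow> j \<in> I \<Longrightarrow> \<exists>w\<in>L. adm (i # w @ [j])"
    using finitely_primitive by (auto simp: finitely_primitive_def adm_words_iff)
  have Lw: "length u = l" "adm u" if "u \<in> L" for u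
    using L(2) that by (auto simp: adm_words_of_length_iff)
  obtain a where a: "a \<in> I" using alphabet_nonempty by blast
  define target where "target = (\<lambda>(u, v). inv (gval u) \<otimes> g \<otimes> inv (gval (a # v)))"
  have target: "target ` (L \<times> L) \<subseteq> carrier G"
    using Lw a g by (auto simp: target_def adm_set)
  obtain n where n: "\<forall>h\<in>target ` (L \<times> L). \<exists>q. length q = n \<and> adm (a # q @ [a]) \<and> gval (a # q) = h"
    using loops_with_value[OF a _ target] L(1) by blast
  define q where "q = (\<lambda>u v. SOME q. length q = n \<and> adm (a # q @ [a]) \<and> gval (a # q) = target (u, v))"
  have q: "length (q u v) = n \<and> adm (a # q u v @ [a]) \<and> gval (a # q u v) = target (u, v)"
    if "u \<in> L" "v \<in> L" for u v
  proof -
    have "target (u, v) \<in> target ` (L \<times> L)" using that by blast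
    then show ?thesis using n unfolding q_def by (intro someI_ex[where P = "\<lambda>q. length q = n \<and>
      adm (a # q @ [a]) \<and> gval (a # q) = target (u, v)"]) blast
  qed
  define c where "c = (\<lambda>(u, v). u @ (a # q u v) @ (a # v))"
  have "\<exists>w\<in>c ` (L \<times> L). length w = l + n + 2 + l \<and> gval w = g \<and> adm (i # w @ [j])"
    if i: "i \<in> I" and j: "j \<in> I" for i j
  proof -
    obtain u v where u: "u \<in> L" "adm (i # u @ [a])" and v: "v \<in> L" "adm (a # v @ [j])"
      using L(3) i j a by meson
    note uv = Lw[OF u(1)] Lw[OF v(1)] q[OF u(1) v(1)]
    have "adm ((i # u @ a # q u v) @ [a])"
      using adm_overlap[of "i # u" a "q u v @ [a]"] u uv by simp
    then have "adm (i # c (u, v) @ [j])"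
      using adm_overlap[of "i # u @ a # q u v" a "v @ [j]"] v by (simp add: c_def)
    moreover have "gval (c (u, v)) = g"
    proof -
      have in_I: "set u \<subseteq> I" "set (a # q u v) \<subseteq> I" "set (a # v) \<subseteq> I"
        using uv a by (auto simp: admissible_def)
      define U Q V where "U = gval u" "Q = gval (a # q u v)" "V = gval (a # v)"
      have cl: "U \<in> carrier G" "Q \<in> carrier G" "V \<in> carrier G"
        using in_I by (auto simp: U_Q_V_def simp del: gval_Cons)
      have "gval (c (u, v)) = U \<otimes> (Q \<otimes> V)"
        using in_I gval_append[of u "(a # q u v) @ (a # v)"] gval_append[OF in_I(2,3)]
        by (simp add: c_def U_Q_V_def del: gval_Cons)
      moreover have "Q = inv U \<otimes> g \<otimes> inv V" using uv by (simp add: U_Q_V_def target_def)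
      moreover have "U \<otimes> (inv U \<otimes> g) = g"
        using cl g by (simp add: m_assoc[symmetric])
      ultimately show ?thesis using cl g by (simp add: m_assoc)
    qed
    ultimately show ?thesis using u v uv
      by (intro bexI[of _ "c (u, v)"]) (auto simp: c_def)
  qed
  moreover have "finite (c ` (L \<times> L))" using L(1) by simp
  ultimately show ?thesis by (intro exI[of _ "l + n + 2 + l"] conjI exI[of _ "c ` (L \<times> L)"]) auto
qed

text \<open>
  The length \<open>l\<close> of the connecting words depends on \<open>g\<close> only. Because it is constant, a glued word together
  with the length of its first factor determines both factors.
\<close>

definition glues :: "'g \<Rightarrow> real \<Rightarrow> nat \<Rightarrow> bool" where
  "glues g c l \<longleftrightarrow> c > 0 \<and> l \<ge> 1 \<and> (\<forall>x y. x \<noteq> [] \<longrightarrow> y \<noteq> [] \<longrightarrow> adm x \<longrightarrow> adm y \<longrightarrow>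
    (\<exists>u. length u = l \<and> gval u = g \<and> adm (x @ u @ y) \<and> c * wt x * wt y \<le> wt (x @ u @ y)))"

lemma gluing:
  assumes "g \<in> carrier G"
  shows "\<exists>c l. glues g c l"
proof -
  obtain l L where l: "l \<ge> 1" "finite L" and
    L: "\<And>i j. i \<in> I \<Longrightarrow> j \<in> I \<Longrightarrow> \<exists>u\<in>L. length u = l \<and> gval u = g \<and> adm (i # u @ [j])"
    using connecting_words[OF assms] by metis
  have "L \<noteq> {}" using L alphabet_nonempty by blast
  define c where "c = exp (- 4 * D) * Min (wt ` L)"
  have "c > 0" using l \<open>L \<noteq> {}\<close> by (auto simp: c_def)
  moreover have "\<exists>u. length u = l \<and> gval u = g \<and> adm (x @ u @ y) \<and> c * wt x * wt y \<le> wt (x @ u @ y)"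
    if xy: "x \<noteq> []" "y \<noteq> []" "adm x" "adm y" for x y
  proof -
    have "last x \<in> I" "hd y \<in> I" using xy by (auto simp: admissible_def)
    then obtain u where u: "u \<in> L" "length u = l" "gval u = g" "adm (last x # u @ [hd y])"
      using L by blast
    have "u \<noteq> []" using u l by auto
    have eq: "butlast x @ last x # z = x @ z" for z
      using append_butlast_last_id[OF xy(1)] by (metis append.assoc append_Cons append_Nil)
    have "adm (x @ u @ [hd y])"
      using adm_overlap[of "butlast x" "last x" "u @ [hd y]"] xy u(4) unfolding eq by simp
    then have adm: "adm (x @ u @ y)"
      using adm_overlap[of "x @ u" "hd y" "tl y"] xy by simp
    have "c * wt x * wt y \<le> (exp (- 4 * D) * wt u) * wt x * wt y"
      unfolding c_def using u l by (intro mult_right_mono mult_left_mono Min_le) auto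
    also have "\<dots> = exp (- 2 * D) * wt x * (exp (- 2 * D) * wt u * wt y)"
      by (simp add: exp_add[symmetric])
    also have "\<dots> \<le> exp (- 2 * D) * wt x * wt (u @ y)"
      using adm by (intro mult_left_mono wt_append_ge) (auto simp: admissible_append)
    also have "\<dots> \<le> wt (x @ u @ y)" using adm by (rule wt_append_ge)
    finally show ?thesis using u adm by blast
  qed
  ultimately show ?thesis using l(1) unfolding glues_def by blast
qed

text \<open>
  Gluing is a map from pairs of words to words, and its multiplicity must be controlled. A glued word is
  required to determine its first factor once the length of that factor is known modulo \<open>K\<close>; the pairs are
  then encoded by the glued word and one of \<open>K\<close> labels. For \<open>K = 1\<close> gluing is injective.
\<close>

lemma gluing_mass:
  assumes "glues g c l" and K: "K > 0"
    and X: "\<And>x. x \<in> X \<Longrightarrow> x \<noteq> [] \<and> adm x"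
    and Y: "\<And>x y. x \<in> X \<Longrightarrow> y \<in> Y x \<Longrightarrow> y \<noteq> [] \<and> adm y"
    and Z: "\<And>x y u. x \<in> X \<Longrightarrow> y \<in> Y x \<Longrightarrow> length u = l \<Longrightarrow> gval u = g \<Longrightarrow> adm (x @ u @ y) \<Longrightarrow>
         x @ u @ y \<in> Z"
    and det: "\<And>x x' u u' y y'. x \<in> X \<Longrightarrow> y \<in> Y x \<Longrightarrow> x' \<in> X \<Longrightarrow> y' \<in> Y x' \<Longrightarrow>
       length u = l \<Longrightarrow> gval u = g \<Longrightarrow> length u' = l \<Longrightarrow>
       gval u' = g \<Longrightarrow> adm (x @ u @ y) \<Longrightarrow> x @ u @ y = x' @ u' @ y' \<Longrightarrow>
       length x mod K = length x' mod K \<Longrightarrow> length x = length x'"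
  shows "ennreal c * (\<Sum>\<^sub>\<infinity>x\<in>X. ennreal (wt x) * mass (Y x)) \<le> of_nat K * mass Z"
proof -
  have "c > 0" using assms(1) by (simp add: glues_def)
  obtain u where u: "\<And>x y. x \<noteq> [] \<Longrightarrow> y \<noteq> [] \<Longrightarrow> adm x \<Longrightarrow> adm y \<Longrightarrow>
    length (u x y) = l \<and> gval (u x y) = g \<and> adm (x @ u x y @ y) \<and> c * wt x * wt y \<le> wt (x @ u x y @ y)"
    using assms(1) unfolding glues_def by metis
  \<comment> \<open>The code of a pair: the glued word and its label.\<close>
  define h where "h = (\<lambda>(x, y). (x @ u x y @ y, length x mod K))"
  have props: "length (u x y) = l" "gval (u x y) = g" "adm (x @ u x y @ y)"
      "c * wt x * wt y \<le> wt (x @ u x y @ y)" if "x \<in> X" "y \<in> Y x" for x y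
    using u[of x y] X Y that by blast+
  have "ennreal c * (\<Sum>\<^sub>\<infinity>x\<in>X. ennreal (wt x) * mass (Y x)) =
      (\<Sum>\<^sub>\<infinity>(x, y)\<in>Sigma X Y. ennreal c * (ennreal (wt x) * ennreal (wt y)))"
    by (simp only: infsum_ennreal_Sigma infsum_ennreal_cmult mass_def)
  also have "\<dots> \<le> (\<Sum>\<^sub>\<infinity>(k, z)\<in>{..<K} \<times> Z. ennreal (wt z))"
  proof (rule infsum_ennreal_inj_le[where h = "\<lambda>p. prod.swap (h p)"])
    show "inj_on (\<lambda>p. prod.swap (h p)) (Sigma X Y)"
    proof (rule inj_onI, clarify)
      fix x y x' y' assume *: "x \<in> X" "y \<in> Y x" "x' \<in> X" "y' \<in> Y x'"
        and eq: "prod.swap (h (x, y)) = prod.swap (h (x', y'))"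
      then have **: "x @ u x y @ y = x' @ u x' y' @ y'" "length x mod K = length x' mod K"
        by (auto simp: h_def)
      have "length x = length x'"
        using det[OF *] ** props * by metis
      then have "x = x'" "u x y @ y = u x' y' @ y'" using ** by auto
      moreover have "length (u x y) = length (u x' y')" using props * by metis
      ultimately show "x = x' \<and> y = y'" by auto
    qed
    show "(\<lambda>p. prod.swap (h p)) ` Sigma X Y \<subseteq> {..<K} \<times> Z"
      using Z props K by (auto simp: h_def)
    fix p assume "p \<in> Sigma X Y"
    then show "(case p of (x, y) \<Rightarrow> ennreal c * (ennreal (wt x) * ennreal (wt y))) \<le>
        (case prod.swap (h p) of (k, z) \<Rightarrow> ennreal (wt z))"
      using props \<open>c > 0\<close>
      by (auto simp: h_def ennreal_mult[symmetric] mult.assoc[symmetric] intro!: ennreal_leI)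
  qed
  also have "\<dots> = of_nat K * mass Z"
    by (subst infsum_ennreal_Sigma) (simp add: mass_def)
  finally show ?thesis .
qed

section \<open>First visits to a group element\<close>

lemma mass_empty [simp]: "mass {} = 0"
  by (simp add: mass_def)

lemma mass_singleton [simp]: "mass {w} = ennreal (wt w)"
  by (simp add: mass_def)

lemma mass_Un_le: "mass (X \<union> Y) \<le> mass X + mass Y"
  unfolding mass_def by (rule infsum_ennreal_Un_le)

lemma mass_times_const: "(\<Sum>\<^sub>\<infinity>x\<in>X. ennreal (wt x) * r) = mass X * r"
  unfolding mass_def by (simp add: mult.commute[of _ r] infsum_ennreal_cmult)

lemma mass_le_if_bounded_length:
  assumes "\<And>N. mass {w \<in> X. length w \<le> N} \<le> b"
  shows "mass X \<le> b"
  unfolding mass_def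
proof (rule infsum_ennreal_le)
  fix F assume F: "finite F" "F \<subseteq> X"
  have "F \<subseteq> {w \<in> X. length w \<le> Max (length ` F)}" using F by auto
  then have "(\<Sum>w\<in>F. ennreal (wt w)) \<le> mass {w \<in> X. length w \<le> Max (length ` F)}"
    unfolding mass_def using F by (intro sum_le_infsum_ennreal) auto
  then show "(\<Sum>w\<in>F. ennreal (wt w)) \<le> b" using assms order_trans by blast
qed

text \<open>
  Upper bounds on masses arise by cutting the words of \<open>X\<close> into two pieces.
\<close>

lemma mass_split:
  assumes split: "\<And>w. w \<in> X \<Longrightarrow> \<exists>u\<in>U. \<exists>v\<in>V. w = u @ v" and adm: "\<And>w. w \<in> X \<Longrightarrow> adm w"
  shows "mass X \<le> mass U * mass V"
proof -
  obtain u v where uv: "\<And>w. w \<in> X \<Longrightarrow> u w \<in> U \<and> v w \<in> V \<and> w = u w @ v w"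
    using split by metis
  have "mass X \<le> (\<Sum>\<^sub>\<infinity>(x, y)\<in>U \<times> V. ennreal (wt x) * ennreal (wt y))"
    unfolding mass_def
  proof (rule infsum_ennreal_inj_le[where h = "\<lambda>w. (u w, v w)"])
    show "inj_on (\<lambda>w. (u w, v w)) X"
    proof (rule inj_onI)
      fix w w' assume "w \<in> X" "w' \<in> X" "(u w, v w) = (u w', v w')"
      then show "w = w'" using uv[of w] uv[of w'] by simp
    qed
    show "(\<lambda>w. (u w, v w)) ` X \<subseteq> U \<times> V" using uv by auto
    fix w assume w: "w \<in> X"
    then have "wt w \<le> wt (u w) * wt (v w)"
      using wt_append_le[of "u w" "v w"] uv[OF w] adm[OF w] by simp
    then show "ennreal (wt w) \<le> (case (u w, v w) of (x, y) \<Rightarrow> ennreal (wt x) * ennreal (wt y))"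
      by (simp add: ennreal_mult[symmetric] ennreal_leI)
  qed
  also have "\<dots> = mass U * mass V"
    by (simp only: infsum_ennreal_product_Sigma mass_def[symmetric] mass_times_const)
  finally show ?thesis .
qed

abbreviation words :: "nat \<Rightarrow> 'a list set" where
  "words \<equiv> adm_words_of_length I A"

definition words_upto :: "'g \<Rightarrow> nat \<Rightarrow> 'a list set" where
  "words_upto g n = {w. w \<noteq> [] \<and> adm w \<and> length w \<le> n \<and> gval w = g}"

text \<open>
  The words of value \<open>g\<close> none of whose proper non-empty prefixes has value \<open>g\<close>. The walk starts at \<open>\<one>\<close>, and
  time \<open>0\<close> is ignored: for \<open>g = \<one>\<close> these are first returns.
\<close>

definition hits :: "'g \<Rightarrow> 'a list set" where
  "hits g = {w. w \<noteq> [] \<and> adm w \<and> gval w = g \<and> (\<forall>k. 0 < k \<longrightarrow> k < length w \<longrightarrow> gval (take k w) \<noteq> g)}"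

definition hits_upto :: "'g \<Rightarrow> nat \<Rightarrow> 'a list set" where
  "hits_upto g n = {w \<in> hits g. length w \<le> n}"

definition avoiding :: "'g \<Rightarrow> 'a list set" where
  "avoiding g = {w. w \<noteq> [] \<and> adm w \<and> gval w = \<one> \<and> (\<forall>k. 0 < k \<longrightarrow> k \<le> length w \<longrightarrow> gval (take k w) \<noteq> g)}"

lemma hits_prefix_free:
  assumes "x \<in> hits g" "x' \<in> hits g" "x @ y = x' @ y'"
  shows "length x = length x'"
proof -
  have *: "\<not> length x < length x'" if "x \<in> hits g" "x' \<in> hits g" "x @ y = x' @ y'" for x x' y y'
  proof
    assume less: "length x < length x'"
    then have "take (length x) x' = take (length x) (x' @ y')" by simp
    also have "\<dots> = x" by (simp add: that(3)[symmetric])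
    finally show False using that less by (auto simp: hits_def)
  qed
  show ?thesis using *[OF assms] *[OF assms(2,1) assms(3)[symmetric]] by simp
qed

lemma first_visit:
  assumes w: "adm w" and k: "0 < k" "k \<le> length w" "gval (take k w) = g"
  shows "\<exists>u\<in>hits g. \<exists>v. w = u @ v \<and> adm v \<and> gval v = inv g \<otimes> gval w"
proof -
  define m where "m = (LEAST k. 0 < k \<and> gval (take k w) = g)"
  have m: "0 < m" "gval (take m w) = g" "m \<le> k"
    using LeastI[of "\<lambda>k. 0 < k \<and> gval (take k w) = g" k] k
      Least_le[of "\<lambda>k. 0 < k \<and> gval (take k w) = g" k] by (auto simp: m_def)
  have least: "gval (take j w) \<noteq> g" if "0 < j" "j < m" for j
    using not_less_Least[of j "\<lambda>k. 0 < k \<and> gval (take k w) = g"] that by (auto simp: m_def)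
  have adm: "adm (take m w)" "adm (drop m w)"
    using w admissible_append[of I A "take m w" "drop m w"] by auto
  have "take m w \<in> hits g"
    using m least k adm by (auto simp: hits_def min_def)
  moreover have "gval w = g \<otimes> gval (drop m w)"
    using gval_adm_append[of "take m w" "drop m w"] w m by simp
  then have "gval (drop m w) = inv g \<otimes> gval w"
    using adm m gval_adm_closed by (metis inv_solve_left w)
  ultimately show ?thesis using adm by (intro bexI[of _ "take m w"] exI[of _ "drop m w"]) auto
qed

text \<open>
  After the first visit to \<open>g\<close>, a word of value \<open>g\<close> continues with a word of value \<open>\<one>\<close>, possibly empty;
  the empty word accounts for the summand \<open>1\<close>.
\<close>

lemma mass_words_upto_le:
  assumes g: "g \<in> carrier G"
  shows "mass (words_upto g n) \<le> mass (hits g) * (1 + mass (words_upto \<one> n))"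
proof -
  have "mass (words_upto g n) \<le> mass (hits g) * mass ({[]} \<union> words_upto \<one> n)"
  proof (rule mass_split)
    fix w assume w: "w \<in> words_upto g n"
    then obtain u v where "u \<in> hits g" "w = u @ v" "adm v" "gval v = inv g \<otimes> gval w"
      using first_visit[of w "length w" g] by (auto simp: words_upto_def)
    moreover from this have "v \<in> {[]} \<union> words_upto \<one> n"
      using w g by (auto simp: words_upto_def)
    ultimately show "\<exists>u\<in>hits g. \<exists>v\<in>{[]} \<union> words_upto \<one> n. w = u @ v" by blast
  qed (auto simp: words_upto_def)
  also have "\<dots> \<le> mass (hits g) * (1 + mass (words_upto \<one> n))"
    using mass_Un_le[of "{[]}" "words_upto \<one> n"] by (intro mult_left_mono) auto
  finally show ?thesis .
qed

text \<open>
  A return to \<open>\<one>\<close> either avoids \<open>g\<close> or continues, after its first visit to \<open>g\<close>, with a word of value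
  \<open>inv g\<close>.
\<close>

lemma mass_returns_le:
  assumes g: "g \<in> carrier G"
  shows "mass (words_upto \<one> n) \<le> mass (avoiding g) + mass (hits g) * (1 + mass (words_upto (inv g) n))"
proof -
  have "words_upto \<one> n \<subseteq> avoiding g \<union> (words_upto \<one> n - avoiding g)" by auto
  then have "mass (words_upto \<one> n) \<le> mass (avoiding g) + mass (words_upto \<one> n - avoiding g)"
    using mass_mono mass_Un_le order_trans by blast
  also have "mass (words_upto \<one> n - avoiding g) \<le> mass (hits g) * mass ({[]} \<union> words_upto (inv g) n)"
  proof (rule mass_split)
    fix w assume w: "w \<in> words_upto \<one> n - avoiding g"
    then obtain k where "0 < k" "k \<le> length w" "gval (take k w) = g"
      by (auto simp: words_upto_def avoiding_def)
    then obtain u v where "u \<in> hits g" "w = u @ v" "adm v" "gval v = inv g \<otimes> gval w"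
      using first_visit[of w k g] w unfolding words_upto_def by blast
    moreover from this have "v \<in> {[]} \<union> words_upto (inv g) n"
      using w g by (auto simp: words_upto_def)
    ultimately show "\<exists>u\<in>hits g. \<exists>v\<in>{[]} \<union> words_upto (inv g) n. w = u @ v" by blast
  qed (auto simp: words_upto_def)
  also have "\<dots> \<le> mass (hits g) * (1 + mass (words_upto (inv g) n))"
    using mass_Un_le[of "{[]}" "words_upto (inv g) n"] by (intro mult_left_mono) auto
  finally show ?thesis by (simp add: add_left_mono)
qed

lemma gval_glued:
  "adm (x @ u @ y) \<Longrightarrow> gval (x @ u @ y) = gval x \<otimes> (gval u \<otimes> gval y)"
  by (simp add: gval_adm_append admissible_append)

text \<open>
  A word has at most one prefix that is a first visit to \<open>g\<close>, so gluing behind first-visit words is injective. The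
  constant does not depend on \<open>g\<close>, which is essential for the uniformity in symmetry on average.
\<close>

lemma hits_times_words_upto_le:
  assumes glues: "glues \<one> c l" and g: "g \<in> carrier G" and h: "h \<in> carrier G"
  shows "ennreal c * (mass (hits_upto g N) * mass (words_upto h n)) \<le> mass (words_upto (g \<otimes> h) (N + n + l))"
proof -
  have "ennreal c * (\<Sum>\<^sub>\<infinity>x\<in>hits_upto g N. ennreal (wt x) * mass (words_upto h n)) \<le>
      of_nat 1 * mass (words_upto (g \<otimes> h) (N + n + l))"
  proof (rule gluing_mass[OF glues])
    show "x @ u @ y \<in> words_upto (g \<otimes> h) (N + n + l)"
      if "x \<in> hits_upto g N" "y \<in> words_upto h n" "length u = l" "gval u = \<one>" "adm (x @ u @ y)" for x u y
      using that h by (auto simp: words_upto_def hits_upto_def hits_def gval_glued)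
    show "length x = length x'"
      if "x \<in> hits_upto g N" "x' \<in> hits_upto g N" "x @ u @ y = x' @ u' @ y'" for x x' u u' y y'
      using that hits_prefix_free[of x g x' "u @ y" "u' @ y'"] by (auto simp: hits_upto_def)
  qed (auto simp: hits_upto_def hits_def words_upto_def)
  then show ?thesis by (simp add: mass_times_const)
qed

text \<open>
  Gluing a connecting word of value \<open>g\<close> and a return to \<open>\<one>\<close> behind a word \<open>x\<close> avoiding \<open>g\<close> gives a word of
  value \<open>g\<close>, whose first visit to \<open>g\<close> takes place within the connecting word. The length of \<open>x\<close> is therefore
  known up to \<open>l\<close> possibilities, and is determined by its residue modulo \<open>l\<close>.
\<close>

lemma avoiding_times_words_upto_le:
  assumes g: "g \<in> carrier G"
  shows "\<exists>c>0. \<exists>l. \<forall>N n. ennreal c * (mass {w \<in> avoiding g. length w \<le> N} * mass (words_upto \<one> n)) \<le>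
           mass (words_upto g (N + n + l))"
proof -
  obtain c l where glues: "glues g c l" using gluing[OF g] by blast
  then have "c > 0" "l \<ge> 1" by (auto simp: glues_def)
  have "ennreal (c / real l) * (mass {w \<in> avoiding g. length w \<le> N} * mass (words_upto \<one> n)) \<le>
      mass (words_upto g (N + n + l))" for N n
  proof -
    let ?X = "{w \<in> avoiding g. length w \<le> N}"
    have long: "length x + l \<le> length x'  \<Longrightarrow> False"
      if x: "x \<in> ?X" "x' \<in> ?X" "gval u = g" "length u = l" "adm (x @ u @ y)" "x @ u @ y = x' @ u' @ y'"
      for x x' u u' y y'
    proof -
      assume le: "length x + l \<le> length x'"
      have "take (length x + l) x' = take (length x + l) (x' @ u' @ y')" using le by simp
      also have "\<dots> = x @ u" using x(4) by (simp add: x(6)[symmetric])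
      finally have "take (length x + l) x' = x @ u" .
      moreover have "gval (x @ u) = g"
        using x(1,3,5) g gval_adm_append[of x u] admissible_append[of I A "x @ u" y]
        by (simp add: avoiding_def)
      moreover have "gval (take (length x + l) x') \<noteq> g"
        using x(2) le \<open>l \<ge> 1\<close> by (simp add: avoiding_def)
      ultimately show False by simp
    qed
    have close: "\<not> length x < length x'"
      if "x \<in> ?X" "x' \<in> ?X" "gval u = g" "length u = l" "adm (x @ u @ y)" "x @ u @ y = x' @ u' @ y'"
        "length x mod l = length x' mod l" for x x' u u' y y'
    proof
      assume less: "length x < length x'"
      then have "l dvd length x' - length x" using that(7) by (metis less_imp_le mod_eq_dvd_iff_nat)
      then have "l \<le> length x' - length x" using less by (intro dvd_imp_le) auto
      then show False using long[OF that(1-6)] less by linarith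
    qed
    have "ennreal c * (\<Sum>\<^sub>\<infinity>x\<in>?X. ennreal (wt x) * mass (words_upto \<one> n)) \<le>
        of_nat l * mass (words_upto g (N + n + l))"
    proof (rule gluing_mass[OF glues])
      show "x @ u @ y \<in> words_upto g (N + n + l)"
        if "x \<in> ?X" "y \<in> words_upto \<one> n" "length u = l" "gval u = g" "adm (x @ u @ y)" for x u y
        using that g by (auto simp: words_upto_def avoiding_def gval_glued)
      show "length x = length x'"
        if "x \<in> ?X" "x' \<in> ?X" "length u = l" "gval u = g" "length u' = l" "gval u' = g" "adm (x @ u @ y)"
          "x @ u @ y = x' @ u' @ y'" "length x mod l = length x' mod l" for x x' u u' y y'
        using close[OF that(1,2,4,3,7,8,9)]
          close[OF that(2,1,6,5) that(7)[unfolded that(8)] that(8)[symmetric] that(9)[symmetric]] by linarith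
    qed (use \<open>l \<ge> 1\<close> in \<open>auto simp: avoiding_def words_upto_def\<close>)
    then have "ennreal c * (mass ?X * mass (words_upto \<one> n)) \<le> of_nat l * mass (words_upto g (N + n + l))"
      by (simp add: mass_times_const)
    then have "ennreal (1 / real l) * (ennreal c * (mass ?X * mass (words_upto \<one> n))) \<le>
        ennreal (1 / real l) * (ennreal (real l) * mass (words_upto g (N + n + l)))"
      by (intro mult_left_mono) (auto simp: ennreal_of_nat_eq_real_of_nat)
    then show ?thesis using \<open>l \<ge> 1\<close> \<open>c > 0\<close>
      by (simp add: mult.assoc[symmetric] ennreal_mult[symmetric])
  qed
  then show ?thesis using \<open>c > 0\<close> \<open>l \<ge> 1\<close> by (intro exI[of _ "c / real l"] conjI exI[of _ l]) auto
qed

text \<open>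
  Append a connecting word and one fixed letter \<open>a\<close> that together have value \<open>inv g \<otimes> h\<close>. Here the
  constant does depend on \<open>g\<close> and \<open>h\<close>.
\<close>

lemma words_upto_comparable:
  assumes g: "g \<in> carrier G" and h: "h \<in> carrier G"
  shows "\<exists>c>0. \<exists>l. \<forall>n. ennreal c * mass (words_upto g n) \<le> mass (words_upto h (n + l))"
proof -
  obtain a where a: "a \<in> I" using alphabet_nonempty by blast
  define s where "s = inv g \<otimes> h \<otimes> inv (\<Psi> [a])"
  have s: "s \<in> carrier G" using g h a by (simp add: s_def)
  have gsa: "g \<otimes> (s \<otimes> \<Psi> [a]) = h"
  proof -
    have "g \<otimes> (inv g \<otimes> h) = h" using g h by (simp add: m_assoc[symmetric])
    then show ?thesis using g h a by (simp add: s_def m_assoc)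
  qed
  obtain c l where glues: "glues s c l" using gluing[OF s] by blast
  then have "c > 0" by (auto simp: glues_def)
  have "ennreal (c * wt [a]) * mass (words_upto g n) \<le> mass (words_upto h (n + (l + 1)))" for n
  proof -
    have "ennreal c * (\<Sum>\<^sub>\<infinity>x\<in>words_upto g n. ennreal (wt x) * mass {[a]}) \<le>
        of_nat 1 * mass (words_upto h (n + (l + 1)))"
    proof (rule gluing_mass[OF glues])
      show "x @ u @ y \<in> words_upto h (n + (l + 1))"
        if "x \<in> words_upto g n" "y \<in> {[a]}" "length u = l" "gval u = s" "adm (x @ u @ y)" for x u y
        using that gsa a by (auto simp: words_upto_def gval_glued)
      show "length x = length x'"
        if "y \<in> {[a]}" "y' \<in> {[a]}" "length u = l" "length u' = l" "x @ u @ y = x' @ u' @ y'"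
        for x x' u u' y y'
        using that arg_cong[OF that(5), of length] by simp
    qed (use a in \<open>auto simp: words_upto_def\<close>)
    then show ?thesis using \<open>c > 0\<close> by (simp add: mass_times_const ennreal_mult mult_ac)
  qed
  then show ?thesis using \<open>c > 0\<close> by (intro exI[of _ "c * wt [a]"] conjI exI[of _ "l + 1"]) auto
qed

text \<open>
  Complete each word of length \<open>n\<close> to a return to \<open>\<one>\<close> by a word with the inverse value.
\<close>

lemma words_times_words_upto_le:
  assumes glues: "glues \<one> c l" and X: "X \<subseteq> words n" and n: "n \<ge> 1"
  shows "ennreal c * (\<Sum>\<^sub>\<infinity>x\<in>X. ennreal (wt x) * mass (words_upto (inv (gval x)) m)) \<le>
    mass (words_upto \<one> (n + m + l))"
proof -
  have "ennreal c * (\<Sum>\<^sub>\<infinity>x\<in>X. ennreal (wt x) * mass (words_upto (inv (gval x)) m)) \<le>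
      of_nat 1 * mass (words_upto \<one> (n + m + l))"
  proof (rule gluing_mass[OF glues])
    show "x @ u @ y \<in> words_upto \<one> (n + m + l)"
      if "x \<in> X" "y \<in> words_upto (inv (gval x)) m" "length u = l" "gval u = \<one>" "adm (x @ u @ y)" for x u y
    proof -
      have "x \<in> words n" using X that(1) by blast
      then show ?thesis using that n gval_adm_closed[of x]
        by (auto simp: words_upto_def gval_glued adm_words_of_length_iff)
    qed
    show "length x = length x'" if "x \<in> X" "x' \<in> X" for x x'
    proof -
      have "x \<in> words n" "x' \<in> words n" using X that by blast+
      then show ?thesis by (simp add: adm_words_of_length_iff)
    qed
    show "x \<noteq> [] \<and> adm x" if "x \<in> X" for x
    proof -
      have "x \<in> words n" using X that by blast
      then show ?thesis using n by (auto simp: adm_words_of_length_iff)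
    qed
  qed (auto simp: words_upto_def)
  then show ?thesis by simp
qed

text \<open>
  Extending first-visit words of length at most \<open>N\<close> to one common length gives distinct words, since no
  first-visit word is a prefix of another. The remainder has length at least \<open>1\<close>, as gluing needs non-empty words.
\<close>

lemma hits_times_words_le:
  assumes glues: "glues \<one> c l"
  shows "ennreal c * (\<Sum>\<^sub>\<infinity>x\<in>hits_upto g N. ennreal (wt x) * mass (words (N + 1 - length x))) \<le>
    mass (words (N + 1 + l))"
proof -
  have "ennreal c * (\<Sum>\<^sub>\<infinity>x\<in>hits_upto g N. ennreal (wt x) * mass (words (N + 1 - length x))) \<le>
      of_nat 1 * mass (words (N + 1 + l))"
  proof (rule gluing_mass[OF glues])
    show "length x = length x'"
      if "x \<in> hits_upto g N" "x' \<in> hits_upto g N" "x @ u @ y = x' @ u' @ y'" for x x' u u' y y'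
      using that hits_prefix_free[of x g x' "u @ y" "u' @ y'"] by (auto simp: hits_upto_def)
  qed (auto simp: hits_upto_def hits_def adm_words_of_length_iff)
  then show ?thesis by simp
qed

section \<open>Loops at a letter\<close>

text \<open>
  The set \<open>H\<close> allows both Markov shifts to be treated at once: \<open>H = {\<one>}\<close> gives the loops of the extension,
  \<open>H = carrier G\<close> those of the base.
\<close>

definition loops :: "'g set \<Rightarrow> 'a \<Rightarrow> nat \<Rightarrow> 'a list set" where
  "loops H a n = {w \<in> words n. w \<noteq> [] \<and> hd w = a \<and> A (last w) a \<and> gval w \<in> H}"

lemma mass_loops_supermult:
  assumes H: "\<And>g h. g \<in> H \<Longrightarrow> h \<in> H \<Longrightarrow> g \<otimes> h \<in> H"
  shows "ennreal (exp (- 2 * D)) * (mass (loops H a m) * mass (loops H a n)) \<le> mass (loops H a (m + n))"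
proof -
  have adm: "adm (u @ v)" if "u \<in> loops H a m" "v \<in> loops H a n" for u v
    using that by (auto simp: loops_def adm_words_of_length_iff admissible_append)
  have "ennreal (exp (- 2 * D)) * (mass (loops H a m) * mass (loops H a n)) =
      (\<Sum>\<^sub>\<infinity>(u, v)\<in>loops H a m \<times> loops H a n. ennreal (exp (- 2 * D)) * (ennreal (wt u) * ennreal (wt v)))"
    by (simp only: infsum_ennreal_Sigma infsum_ennreal_cmult mass_def[symmetric] mass_times_const)
  also have "\<dots> \<le> mass (loops H a (m + n))"
    unfolding mass_def
  proof (rule infsum_ennreal_inj_le[where h = "\<lambda>(u, v). u @ v"])
    show "inj_on (\<lambda>(u, v). u @ v) (loops H a m \<times> loops H a n)"
      by (auto simp: inj_on_def loops_def adm_words_of_length_iff)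
    show "(\<lambda>(u, v). u @ v) ` (loops H a m \<times> loops H a n) \<subseteq> loops H a (m + n)"
      using adm by (fastforce simp: loops_def adm_words_of_length_iff gval_adm_append H)
    fix p assume "p \<in> loops H a m \<times> loops H a n"
    then show "(case p of (u, v) \<Rightarrow> ennreal (exp (- 2 * D)) * (ennreal (wt u) * ennreal (wt v))) \<le>
        ennreal (wt (case p of (u, v) \<Rightarrow> u @ v))"
      using wt_append_ge adm
      by (auto simp: ennreal_mult[symmetric] mult.assoc[symmetric] intro!: ennreal_leI)
  qed
  finally show ?thesis .
qed

text \<open>
  Every word becomes a loop at \<open>a\<close> by gluing the letter \<open>a\<close> in front of it and a connecting word to \<open>a\<close> behind
  it. The first connecting word has value \<open>inv (\<Psi> [a])\<close>, so that the value of the word is not changed.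
\<close>

lemma mass_words_le_loops:
  assumes a: "a \<in> I" and H: "\<one> \<in> H" "H \<subseteq> carrier G"
  shows "\<exists>c>0. \<exists>l. \<forall>n\<ge>1. ennreal c * mass {w \<in> words n. gval w \<in> H} \<le> mass (loops H a (n + l))"
proof -
  have Psi: "\<Psi> [a] \<in> carrier G" using a by simp
  obtain c1 l1 where glues1: "glues (inv (\<Psi> [a])) c1 l1" using gluing[of "inv (\<Psi> [a])"] Psi by auto
  obtain c2 l2 where glues2: "glues \<one> c2 l2" using gluing[of \<one>] by auto
  have c: "c1 > 0" "c2 > 0" "l1 \<ge> 1" "l2 \<ge> 1" using glues1 glues2 by (auto simp: glues_def)
  have "ennreal (c2 * c1 * wt [a]) * mass {w \<in> words n. gval w \<in> H} \<le> mass (loops H a (n + (l1 + l2 + 1)))"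
    if n: "n \<ge> 1" for n
  proof -
    define Z where "Z = {w \<in> words (n + l1 + 1). w \<noteq> [] \<and> hd w = a \<and> gval w \<in> H}"
    have 1: "ennreal c1 * (\<Sum>\<^sub>\<infinity>x\<in>{[a]}. ennreal (wt x) * mass {w \<in> words n. gval w \<in> H}) \<le> of_nat 1 * mass Z"
    proof (rule gluing_mass[OF glues1])
      show "x @ u @ y \<in> Z"
        if "x \<in> {[a]}" "y \<in> {w \<in> words n. gval w \<in> H}" "length u = l1" "gval u = inv (\<Psi> [a])" "adm (x @ u @ y)"
        for x u y
      proof -
        have "gval y \<in> carrier G" using that(2) H by auto
        then have "gval (x @ u @ y) = gval y"
          using that Psi gval_glued[OF that(5)] by (simp add: m_assoc[symmetric])
        then show ?thesis using that by (auto simp: Z_def adm_words_of_length_iff)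
      qed
    qed (use a n in \<open>auto simp: adm_words_of_length_iff\<close>)
    \<comment> \<open>The letter \<open>a\<close> glued at the end only guarantees the transition back to \<open>a\<close>; it is removed again in the next step.\<close>
    have 2: "ennreal c2 * (\<Sum>\<^sub>\<infinity>x\<in>Z. ennreal (wt x) * mass {[a]}) \<le>
        of_nat 1 * mass ((\<lambda>v. v @ [a]) ` loops H a (n + (l1 + l2 + 1)))"
    proof (rule gluing_mass[OF glues2])
      show "x @ u @ y \<in> (\<lambda>v. v @ [a]) ` loops H a (n + (l1 + l2 + 1))"
        if "x \<in> Z" "y \<in> {[a]}" "length u = l2" "gval u = \<one>" "adm (x @ u @ y)" for x u y
      proof -
        have "u \<noteq> []" using that c by auto
        have adm: "adm ((x @ u) @ [a])" using that by simp
        then have *: "adm (x @ u)" "A (last (x @ u)) a"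
          using \<open>u \<noteq> []\<close> admissible_append[of I A "x @ u" "[a]"] by auto
        have "gval x \<in> carrier G" using that(1) H by (auto simp: Z_def)
        then have "gval (x @ u) = gval x" using gval_adm_append[OF *(1)] that by simp
        then have "x @ u \<in> loops H a (n + (l1 + l2 + 1))"
          using * that by (auto simp: loops_def Z_def adm_words_of_length_iff)
        then show ?thesis using that by auto
      qed
    qed (use a in \<open>auto simp: Z_def adm_words_of_length_iff\<close>)
    have 3: "mass ((\<lambda>v. v @ [a]) ` loops H a (n + (l1 + l2 + 1))) \<le>
        mass (loops H a (n + (l1 + l2 + 1))) * mass {[a]}"
      by (rule mass_split) (use a in \<open>auto simp: loops_def adm_words_of_length_iff admissible_append\<close>)
    have "ennreal c1 * ennreal (wt [a]) * mass {w \<in> words n. gval w \<in> H} \<le> mass Z"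
      using 1 by (simp add: mult.assoc)
    moreover have "ennreal c2 * mass Z \<le> mass (loops H a (n + (l1 + l2 + 1)))"
    proof -
      have "ennreal (wt [a]) * (ennreal c2 * mass Z) \<le>
          ennreal (wt [a]) * mass (loops H a (n + (l1 + l2 + 1)))"
        using order_trans[OF 2[unfolded mass_times_const of_nat_1 mult_1] 3] by (simp add: mult_ac)
      then show ?thesis by (subst (asm) ennreal_mult_le_mult_iff) (auto simp: less_imp_neq[symmetric])
    qed
    ultimately have "ennreal c2 * (ennreal c1 * ennreal (wt [a]) * mass {w \<in> words n. gval w \<in> H}) \<le>
        mass (loops H a (n + (l1 + l2 + 1)))"
      by (meson mult_left_mono order_trans zero_le)
    then show ?thesis using c by (simp add: ennreal_mult mult_ac)
  qed
  then show ?thesis using c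
    by (intro exI[of _ "c2 * c1 * wt [a]"] conjI exI[of _ "l1 + l2 + 1"]) auto
qed

section \<open>Periodic points\<close>

definition periodic_sum :: "'g set \<Rightarrow> 'a \<Rightarrow> nat \<Rightarrow> ennreal" where
  "periodic_sum H a n =
     (\<Sum>\<^sub>\<infinity>x\<in>{x \<in> markov_space I A. x 0 = a \<and> (shift_map ^^ n) x = x \<and> gval (map x [0..<n]) \<in> H}.
        ennreal (exp (birkhoff_sum \<phi> n x)))"

lemma partition_fun_base: "partition_fun I A \<phi> a n = periodic_sum (carrier G) a n"
proof -
  have "gval (map x [0..<n]) \<in> carrier G" if "x \<in> markov_space I A" for x
    using gval_adm_closed[OF admissible_initial_block[OF that]] .
  then show ?thesis unfolding partition_fun_def periodic_sum_def
    by (intro infsum_cong_neutral) auto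
qed

text \<open>
  The group coordinate of a point of the extension moves by right multiplication with the values of the
  letters passed.
\<close>

lemma ext_second_coordinate:
  assumes "x \<in> markov_space (ext_alphabet I G) (ext_trans A G \<Psi>)"
  shows "snd (x j) = snd (x 0) \<otimes> gval (map (proj1 x) [0..<j])"
proof (induction j)
  case 0
  then show ?case using assms by (simp add: markov_space_ext)
next
  case (Suc j)
  have x: "proj1 x \<in> markov_space I A" "snd (x 0) \<in> carrier G"
      "snd (x (Suc j)) = snd (x j) \<otimes> \<Psi> [proj1 x j]"
    using assms by (auto simp: markov_space_ext proj1_def)
  have adm: "adm (map (proj1 x) [0..<j] @ [proj1 x j])"
    using admissible_initial_block[OF x(1), of "Suc j"] by simp
  then have "gval (map (proj1 x) [0..<j]) \<in> carrier G" "proj1 x j \<in> I"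
    by (auto simp: admissible_append gval_adm_closed)
  then show ?case using Suc x gval_adm_append[OF adm] by (simp add: m_assoc)
qed

lemma proj1_shift_power: "proj1 ((shift_map ^^ n) x) = (shift_map ^^ n) (proj1 x)"
  by (simp add: shift_map_power proj1_def)

text \<open>
  A periodic point of the extension starting at \<open>(a, h)\<close> is the lift of a periodic point of the base whose
  period block has value \<open>\<one>\<close>, and for each \<open>h\<close> there is exactly one lift.
\<close>

lemma partition_fun_ext:
  assumes h: "h \<in> carrier G"
  shows "partition_fun (ext_alphabet I G) (ext_trans A G \<Psi>) (\<phi> \<circ> proj1) (a, h) n = periodic_sum {\<one>} a n"
proof -
  let ?X = "markov_space (ext_alphabet I G) (ext_trans A G \<Psi>)"
  let ?S = "{x \<in> ?X. x 0 = (a, h) \<and> (shift_map ^^ n) x = x}"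
  let ?T = "{x \<in> markov_space I A. x 0 = a \<and> (shift_map ^^ n) x = x \<and> gval (map x [0..<n]) \<in> {\<one>}}"
  have bij: "bij_betw (\<lambda>x. (proj1 x, snd (x 0))) ?X (markov_space I A \<times> carrier G)"
    by (rule ext_conjugacy_bij[OF is_group hom])
  have eqI: "x = y" if "x \<in> ?X" "y \<in> ?X" "proj1 x = proj1 y" "snd (x 0) = snd (y 0)" for x y
    using bij_betw_imp_inj_on[OF bij] that by (auto dest: inj_onD)
  have inj: "inj_on proj1 ?S" by (rule inj_onI) (auto intro: eqI)
  have base: "proj1 x \<in> markov_space I A" if "x \<in> ?X" for x
    using that by (simp add: markov_space_ext)
  have val: "gval (map (proj1 x) [0..<n]) \<in> carrier G" if "x \<in> ?X" for x
    using gval_adm_closed[OF admissible_initial_block[OF base[OF that]]] .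
  have fixed: "(shift_map ^^ n) x = x \<longleftrightarrow> (shift_map ^^ n) (proj1 x) = proj1 x \<and> gval (map (proj1 x) [0..<n]) = \<one>"
    if x: "x \<in> ?X" "x 0 = (a, h)" for x
  proof
    assume eq: "(shift_map ^^ n) x = x"
    then have "x n = x 0" by (auto simp: shift_map_power dest: fun_cong[of _ _ 0])
    then have "h \<otimes> gval (map (proj1 x) [0..<n]) = h"
      using ext_second_coordinate[OF x(1), of n] x by simp
    then have "gval (map (proj1 x) [0..<n]) = \<one>" using h val[OF x(1)] by simp
    then show "(shift_map ^^ n) (proj1 x) = proj1 x \<and> gval (map (proj1 x) [0..<n]) = \<one>"
      using eq proj1_shift_power[of n x] by simp
  next
    assume eq: "(shift_map ^^ n) (proj1 x) = proj1 x \<and> gval (map (proj1 x) [0..<n]) = \<one>"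
    show "(shift_map ^^ n) x = x"
    proof (rule eqI)
      show "(shift_map ^^ n) x \<in> ?X" using x(1) by (rule shift_power_in_markov_space)
      show "snd ((shift_map ^^ n) x 0) = snd (x 0)"
        using ext_second_coordinate[OF x(1), of n] eq x h by (simp add: shift_map_power)
    qed (use x eq proj1_shift_power[of n x] in auto)
  qed
  have "proj1 ` ?S = ?T"
  proof (intro equalityI subsetI)
    fix y assume "y \<in> proj1 ` ?S"
    then obtain x where x: "x \<in> ?X" "x 0 = (a, h)" "(shift_map ^^ n) x = x" "y = proj1 x" by blast
    then show "y \<in> ?T" using fixed[OF x(1,2)] base[OF x(1)] by (simp add: proj1_def)
  next
    fix y assume y: "y \<in> ?T"
    then have "(y, h) \<in> (\<lambda>x. (proj1 x, snd (x 0))) ` ?X"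
      using h bij_betw_imp_surj_on[OF bij] by auto
    then obtain x where x: "x \<in> ?X" "y = proj1 x" "h = snd (x 0)" by auto
    then have "x 0 = (a, h)" using y by (auto simp: proj1_def prod_eq_iff)
    then show "y \<in> proj1 ` ?S" using x y fixed[OF x(1)] by auto
  qed
  moreover have "birkhoff_sum (\<phi> \<circ> proj1) n x = birkhoff_sum \<phi> n (proj1 x)" for x :: "nat \<Rightarrow> 'a \<times> 'g"
    by (simp add: birkhoff_sum_def proj1_shift_power)
  ultimately show ?thesis
    unfolding partition_fun_def periodic_sum_def
    using infsum_reindex[OF inj, of "\<lambda>x. ennreal (exp (birkhoff_sum \<phi> n x))"] by (simp add: o_def)
qed

text \<open>
  Periodic points correspond to loops by reading off one period. Together with the next lemma this
  replaces partition functions by masses of loops, up to the distortion constant.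
\<close>

lemma periodic_sum_le_loops:
  assumes n: "n \<ge> 1"
  shows "ennreal (exp (- real n * P)) * periodic_sum H a n \<le> mass (loops H a n)"
  unfolding periodic_sum_def infsum_ennreal_cmult[symmetric] mass_def
proof (rule infsum_ennreal_inj_le[where h = "\<lambda>x. map x [0..<n]"])
  let ?S = "{x \<in> markov_space I A. x 0 = a \<and> (shift_map ^^ n) x = x \<and> gval (map x [0..<n]) \<in> H}"
  have periodic: "x i = x (i mod n)" if "(shift_map ^^ n) x = x" for x :: "nat \<Rightarrow> 'a" and i
  proof (induction i rule: less_induct)
    case (less i)
    show ?case
    proof (cases "i < n")
      case False
      then have "x i = (shift_map ^^ n) x (i - n)" by (simp add: shift_map_power)
      also have "\<dots> = x (i - n)" using that by simp
      also have "\<dots> = x ((i - n) mod n)" using less False n by simp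
      also have "(i - n) mod n = i mod n" using False by (simp add: le_mod_geq)
      finally show ?thesis .
    qed simp
  qed
  show "inj_on (\<lambda>x. map x [0..<n]) ?S"
  proof (rule inj_onI, rule ext)
    fix x y i assume x: "x \<in> ?S" and y: "y \<in> ?S" and eq: "map x [0..<n] = map y [0..<n]"
    have "x (i mod n) = y (i mod n)" using eq n by simp
    then show "x i = y i" using periodic[of x i] periodic[of y i] x y by simp
  qed
  show "(\<lambda>x. map x [0..<n]) ` ?S \<subseteq> loops H a n"
  proof clarify
    fix x assume x: "x \<in> markov_space I A" "a = x 0" "(shift_map ^^ n) x = x" "gval (map x [0..<n]) \<in> H"
    obtain m where m: "n = Suc m" using n by (cases n) auto
    have "x n = x 0" using periodic[OF x(3), of n] by simp
    then have "A (x m) (x 0)" using x(1) m by (auto simp: markov_space_def) metis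
    then show "map x [0..<n] \<in> loops H (x 0) n"
      using x m admissible_initial_block[OF x(1), of n]
      by (auto simp: loops_def adm_words_of_length_iff hd_map last_map simp del: upt_Suc)
        (simp add: upt_conv_Cons)?
  qed
  fix x assume x: "x \<in> ?S"
  then have "x \<in> cylinder I A (map x [0..<n])" by (auto simp: in_cylinder_iff)
  from wt_ge[OF this] have "exp (birkhoff_sum \<phi> n x - real n * P) \<le> wt (map x [0..<n])" by simp
  then show "ennreal (exp (- real n * P)) * ennreal (exp (birkhoff_sum \<phi> n x)) \<le> ennreal (wt (map x [0..<n]))"
    by (simp add: ennreal_mult[symmetric] exp_add[symmetric])
qed

lemma loops_le_periodic_sum:
  assumes n: "n \<ge> 1"
  shows "mass (loops H a n) \<le> ennreal (exp D) * (ennreal (exp (- real n * P)) * periodic_sum H a n)"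
  unfolding periodic_sum_def infsum_ennreal_cmult[symmetric] mass_def
proof (rule infsum_ennreal_inj_le[where h = "\<lambda>w i. w ! (i mod n)"])
  have block: "map (\<lambda>i. w ! (i mod n)) [0..<n] = w" if "w \<in> loops H a n" for w
    using that by (intro nth_equalityI) (auto simp: loops_def adm_words_of_length_iff)
  show "inj_on (\<lambda>w i. w ! (i mod n)) (loops H a n)"
  proof (rule inj_onI)
    fix w w' assume "w \<in> loops H a n" "w' \<in> loops H a n" "(\<lambda>i. w ! (i mod n)) = (\<lambda>i. w' ! (i mod n))"
    then show "w = w'" using block[of w] block[of w'] by metis
  qed
  have point: "(\<lambda>i. w ! (i mod n)) \<in> markov_space I A" if "w \<in> loops H a n" for w
  proof -
    have w: "length w = n" "adm w" "w \<noteq> []" "hd w = a" "A (last w) a"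
      using that by (auto simp: loops_def adm_words_of_length_iff)
    have "w ! (i mod n) \<in> I" for i using w n by (auto simp: admissible_def)
    moreover have "A (w ! (i mod n)) (w ! (Suc i mod n))" for i
    proof (cases "Suc (i mod n) = n")
      case True
      then have "Suc i mod n = 0" "i mod n = n - 1" by (auto simp: mod_Suc)
      then show ?thesis using w by (simp add: hd_conv_nth last_conv_nth)
    next
      case False
      then have "Suc (i mod n) < n" using n by (simp add: Suc_lessI)
      then show ?thesis using w False
        by (auto simp: mod_Suc admissible_def successively_conv_nth)
    qed
    ultimately show ?thesis by (auto simp: markov_space_def)
  qed
  show "(\<lambda>w i. w ! (i mod n)) ` loops H a n \<subseteq>
      {x \<in> markov_space I A. x 0 = a \<and> (shift_map ^^ n) x = x \<and> gval (map x [0..<n]) \<in> H}"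
  proof (rule image_subsetI)
    fix w assume w: "w \<in> loops H a n"
    then have "w ! 0 = a" "gval w \<in> H" by (auto simp: loops_def hd_conv_nth)
    then show "(\<lambda>i. w ! (i mod n)) \<in> {x \<in> markov_space I A. x 0 = a \<and> (shift_map ^^ n) x = x \<and> gval (map x [0..<n]) \<in> H}"
      using point[OF w] block[OF w] by (simp add: shift_map_power)
  qed
  fix w assume w: "w \<in> loops H a n"
  then have "length w = n" by (simp add: loops_def adm_words_of_length_iff)
  moreover have "(\<lambda>i. w ! (i mod n)) \<in> cylinder I A w"
    using point[OF w] \<open>length w = n\<close> by (simp add: in_cylinder_iff)
  ultimately have "wt w \<le> exp D * exp (birkhoff_sum \<phi> n (\<lambda>i. w ! (i mod n)) - real n * P)"
    using wt_le by metis
  then show "ennreal (wt w) \<le> ennreal (exp D) *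
      (ennreal (exp (- real n * P)) * ennreal (exp (birkhoff_sum \<phi> n (\<lambda>i. w ! (i mod n)))))"
    by (simp add: ennreal_mult[symmetric] exp_add[symmetric] ennreal_leI)
qed

section \<open>Pressure\<close>

text \<open>
  The letter chosen in the definition of the pressure is kept as an unspecified letter \<open>a\<close>; the bounds
  below hold at every letter.
\<close>

lemma ext_pressure_eq_growth_rate:
  "\<exists>a\<in>I. ext_pressure I A G \<Psi> \<phi> = growth_rate (periodic_sum {\<one>} a)"
proof -
  have "\<exists>b. b \<in> ext_alphabet I G" using alphabet_nonempty by (auto simp: ext_alphabet_def)
  then have "(SOME b. b \<in> ext_alphabet I G) \<in> ext_alphabet I G" by (rule someI_ex)
  then obtain a h where "(SOME b. b \<in> ext_alphabet I G) = (a, h)" "a \<in> I" "h \<in> carrier G"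
    by (auto simp: ext_alphabet_def)
  then show ?thesis
    by (auto simp: ext_pressure_def gurevich_pressure_def growth_rate_def partition_fun_ext)
qed

lemma base_pressure_eq_growth_rate:
  "\<exists>a\<in>I. gurevich_pressure I A \<phi> = growth_rate (periodic_sum (carrier G) a)"
proof -
  have "(SOME a. a \<in> I) \<in> I" using alphabet_nonempty by (simp add: some_in_eq)
  then show ?thesis by (auto simp: gurevich_pressure_def growth_rate_def partition_fun_base)
qed

lemma growth_rate_le_if_bounded:
  assumes "\<And>n. n \<ge> 1 \<Longrightarrow> mass {w \<in> words n. gval w \<in> H} \<le> ennreal C" "C > 0"
  shows "growth_rate (periodic_sum H a) \<le> ereal P"
proof (rule growth_rate_le[OF _ \<open>C > 0\<close>])
  fix n :: nat assume n: "n \<ge> 1"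
  have "mass (loops H a n) \<le> mass {w \<in> words n. gval w \<in> H}"
    by (rule mass_mono) (auto simp: loops_def)
  then have "ennreal (exp (- real n * P)) * periodic_sum H a n \<le> ennreal C"
    by (rule order_trans[OF order_trans[OF periodic_sum_le_loops[OF n]] assms(1)[OF n]])
  then have "ennreal (exp (real n * P)) * (ennreal (exp (- real n * P)) * periodic_sum H a n) \<le>
      ennreal (exp (real n * P)) * ennreal C"
    by (intro mult_left_mono) auto
  then show "periodic_sum H a n \<le> ennreal (C * exp (real n * P))"
    using \<open>C > 0\<close> by (simp add: mult.assoc[symmetric] ennreal_mult[symmetric] exp_add[symmetric] mult.commute)
qed

text \<open>
  Concatenation makes the mass of loops supermultiplicative up to the factor \<open>exp (- 2 * D)\<close>. A single
  \<open>n\<close> at which the normalised mass exceeds \<open>exp (2 * D)\<close> would thus force exponential growth along the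
  multiples of \<open>n\<close> at a rate larger than \<open>P\<close>.
\<close>

lemma mass_loops_le:
  assumes H: "\<And>g h. g \<in> H \<Longrightarrow> h \<in> H \<Longrightarrow> g \<otimes> h \<in> H"
    and rate: "growth_rate (periodic_sum H a) \<le> ereal P" and n: "n \<ge> 1"
  shows "mass (loops H a n) \<le> ennreal (exp (2 * D))"
proof (rule ccontr)
  let ?d = "ennreal (exp (- 2 * D))"
  assume "\<not> ?thesis"
  then have gt: "ennreal (exp (2 * D)) < mass (loops H a n)" by simp
  then obtain r where r: "ennreal (exp (2 * D)) < r" "r < mass (loops H a n)" using dense by blast
  then have "r < \<infinity>" using order_less_le_trans top_greatest by (metis infinity_ennreal_def)
  then obtain \<rho> where \<rho>: "\<rho> \<ge> 0" "r = ennreal \<rho>" by (cases r) auto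
  define \<theta> where "\<theta> = exp (- 2 * D) * \<rho>"
  have "exp (2 * D) < \<rho>" using r(1) \<rho> by (simp add: ennreal_less_iff)
  then have "exp (- 2 * D) * exp (2 * D) < \<theta>" unfolding \<theta>_def by (intro mult_strict_left_mono) auto
  then have \<theta>: "\<theta> > 1" by (simp add: exp_add[symmetric])
  have step: "ennreal \<theta> \<le> ?d * mass (loops H a n)"
  proof -
    have "ennreal \<theta> = ?d * r" using \<rho> by (simp add: \<theta>_def ennreal_mult)
    then show ?thesis using r by (simp add: mult_left_mono less_imp_le)
  qed
  \<comment> \<open>The induction starts at exponent 1: the empty word is not a loop.\<close>
  have power: "ennreal (\<theta> ^ Suc k) \<le> ?d * mass (loops H a (Suc k * n))" for k
  proof (induction k)
    case 0
    then show ?case using step by simp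
  next
    case (Suc k)
    have "ennreal (\<theta> ^ Suc (Suc k)) = ennreal \<theta> * ennreal (\<theta> ^ Suc k)"
      using \<theta> by (simp add: ennreal_mult[symmetric])
    also have "\<dots> \<le> (?d * mass (loops H a n)) * (?d * mass (loops H a (Suc k * n)))"
      by (intro mult_mono step Suc.IH) auto
    also have "\<dots> = ?d * (?d * (mass (loops H a n) * mass (loops H a (Suc k * n))))"
      by (simp add: mult_ac)
    also have "\<dots> \<le> ?d * mass (loops H a (n + Suc k * n))"
      by (intro mult_left_mono mass_loops_supermult H) auto
    finally show ?case by (simp add: add.assoc)
  qed
  have "ereal P < growth_rate (periodic_sum H a)"
  proof (rule growth_rate_gt[OF _ \<theta> n])
    fix k :: nat assume "k \<ge> 1"
    then obtain j where j: "k = Suc j" by (cases k) auto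
    have kn: "1 \<le> k * n" using \<open>k \<ge> 1\<close> n by simp
    have "ennreal (\<theta> ^ k) \<le> ?d * mass (loops H a (k * n))" using power j by simp
    also have "\<dots> \<le> ?d * (ennreal (exp D) * (ennreal (exp (- real (k * n) * P)) * periodic_sum H a (k * n)))"
      by (intro mult_left_mono loops_le_periodic_sum kn) auto
    also have "\<dots> = ennreal (exp (- D)) * (ennreal (exp (- real (k * n) * P)) * periodic_sum H a (k * n))"
      by (simp add: mult.assoc[symmetric] ennreal_mult[symmetric] exp_add[symmetric])
    also have "\<dots> \<le> 1 * (ennreal (exp (- real (k * n) * P)) * periodic_sum H a (k * n))"
      using D_nonneg by (intro mult_right_mono) auto
    finally have "ennreal (exp (real (k * n) * P)) * ennreal (\<theta> ^ k) \<le>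
        ennreal (exp (real (k * n) * P)) * (ennreal (exp (- real (k * n) * P)) * periodic_sum H a (k * n))"
      by (intro mult_left_mono) auto
    then show "ennreal (\<theta> ^ k * exp (real (k * n) * P)) \<le> periodic_sum H a (k * n)"
      using \<theta> by (simp add: mult.assoc[symmetric] ennreal_mult[symmetric] exp_add[symmetric] mult.commute
          del: of_nat_mult)
  qed
  then show False using rate by simp
qed

text \<open>
  If \<open>P\<close> is at least the pressure, the normalised mass of the words of length \<open>n\<close> does not grow at all;
  no subexponential factor is lost, which is what the uniform estimates need.
\<close>

lemma mass_words_bounded:
  assumes a: "a \<in> I" and H: "\<one> \<in> H" "H \<subseteq> carrier G" "\<And>g h. g \<in> H \<Longrightarrow> h \<in> H \<Longrightarrow> g \<otimes> h \<in> H"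
    and rate: "growth_rate (periodic_sum H a) \<le> ereal P"
  shows "\<exists>C>0. \<forall>n\<ge>1. mass {w \<in> words n. gval w \<in> H} \<le> ennreal C"
proof -
  obtain c l where c: "c > 0" and
    le: "\<And>n. n \<ge> 1 \<Longrightarrow> ennreal c * mass {w \<in> words n. gval w \<in> H} \<le> mass (loops H a (n + l))"
    using mass_words_le_loops[OF a H(1,2)] by blast
  have "mass {w \<in> words n. gval w \<in> H} \<le> ennreal (exp (2 * D) / c)" if n: "n \<ge> 1" for n
  proof -
    have "ennreal c * mass {w \<in> words n. gval w \<in> H} \<le> ennreal (exp (2 * D))"
      using le[OF n] mass_loops_le[OF H(3) rate, of "n + l"] n by (meson order_trans trans_le_add1)
    also have "\<dots> = ennreal c * ennreal (exp (2 * D) / c)"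
      using c by (simp add: ennreal_mult[symmetric])
    finally show ?thesis using c by (subst (asm) ennreal_mult_le_mult_iff) auto
  qed
  then show ?thesis using c by (intro exI[of _ "exp (2 * D) / c"]) auto
qed

text \<open>
  A single loop already has a definite weight, which tends to infinity as the normalisation \<open>P\<close> tends to
  \<open>- \<infinity>\<close>. If the growth rate were \<open>- \<infinity>\<close>, all loops would have bounded weight, whatever \<open>P\<close> is.
\<close>

lemma growth_rate_not_MInf:
  assumes a: "a \<in> I"
  shows "growth_rate (periodic_sum {\<one>} a) \<noteq> - \<infinity>"
proof
  assume MInf: "growth_rate (periodic_sum {\<one>} a) = - \<infinity>"
  obtain q where q: "adm (a # q @ [a])" "gval (a # q) = \<one>"
    using loops_with_value[OF a, of "{\<one>}"] by auto
  let ?w = "a # q"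
  have w: "adm ?w" "A (last ?w) a"
    using q(1) admissible_append[of I A ?w "[a]"] by auto
  obtain x where x: "x \<in> cylinder I A ?w" using adm_cylinder_nonempty[OF w(1)] by blast
  \<comment> \<open>The normalisation that gives the loop a weight of at least \<open>exp (2 * D + 1)\<close>.\<close>
  define P' where "P' = (birkhoff_sum \<phi> (length ?w) x - 2 * D - 1) / real (length ?w)"
  have P': "birkhoff_sum \<phi> (length ?w) x - real (length ?w) * P' = 2 * D + 1"
    by (simp add: P'_def)
  interpret Q: group_extended_shift G I A \<Psi> \<phi> D P' ..
  have "Q.mass {?w} \<le> Q.mass (loops {\<one>} a (length ?w))"
    using w q by (intro Q.mass_mono) (auto simp: loops_def adm_words_of_length_iff)
  also have "\<dots> \<le> ennreal (exp (2 * D))"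
    by (rule Q.mass_loops_le) (use MInf in auto)
  finally have "Q.wt ?w \<le> exp (2 * D)" by (simp add: ennreal_le_iff)
  moreover have "exp (2 * D + 1) \<le> Q.wt ?w" using Q.wt_ge[OF x] unfolding P' .
  ultimately have "exp (2 * D + 1) \<le> exp (2 * D)" by linarith
  then show False by simp
qed

section \<open>Partial sums over words of a given value\<close>

lemma mass_words_upto_Suc:
  "mass (words_upto g (Suc n)) = mass (words_upto g n) + mass {w \<in> words (Suc n). gval w = g}"
proof -
  have "words_upto g (Suc n) = words_upto g n \<union> {w \<in> words (Suc n). gval w = g}"
    by (auto simp: words_upto_def adm_words_of_length_iff)
  moreover have "words_upto g n \<inter> {w \<in> words (Suc n). gval w = g} = {}"
    by (auto simp: words_upto_def adm_words_of_length_iff)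
  ultimately show ?thesis unfolding mass_def by (simp add: infsum_ennreal_Un_disjoint)
qed

lemma mass_words_upto_sum: "mass (words_upto g n) = (\<Sum>k=1..n. mass {w \<in> words k. gval w = g})"
proof (induction n)
  case 0
  have "words_upto g 0 = {}" by (auto simp: words_upto_def)
  then show ?case by simp
qed (simp add: mass_words_upto_Suc)

lemma weighted_sum_eq_mass: "weighted_sum I A \<Psi> \<phi> P g n = mass (words_upto g n)"
  unfolding weighted_sum_def mass_words_upto_sum
proof (rule sum.cong)
  fix k assume k: "k \<in> {1..n}"
  have *: "{w \<in> words k. \<Psi> w = g} = {w \<in> words k. gval w = g}"
  proof -
    have "\<Psi> w = gval w" if "w \<in> words k" for w
      using that k by (intro Psi_eq_gval) (auto simp: adm_words_of_length_iff admissible_def)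
    then show ?thesis by auto
  qed
  have "ennreal (exp (- real k * P)) * (\<Sum>\<^sub>\<infinity>w\<in>{w \<in> words k. gval w = g}.
           ennreal (exp (SUP x\<in>cylinder I A w. birkhoff_sum \<phi> k x))) = mass {w \<in> words k. gval w = g}"
    unfolding mass_def infsum_ennreal_cmult[symmetric]
    by (intro infsum_cong)
      (auto simp: wt_def adm_words_of_length_iff ennreal_mult[symmetric] exp_add[symmetric])
  then show "ennreal (exp (- real k * P)) * (\<Sum>\<^sub>\<infinity>w\<in>{w \<in> words k. \<Psi> w = g}.
           ennreal (exp (SUP x\<in>cylinder I A w. birkhoff_sum \<phi> k x))) = mass {w \<in> words k. gval w = g}"
    unfolding * .
qed simp

text \<open>
  Recurrence is stated for the periodic points at some letter; these are dominated by all returns to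
  \<open>\<one>\<close>.
\<close>

lemma recurrent_imp_unbounded:
  assumes rec: "recurrent (ext_alphabet I G) (ext_trans A G \<Psi>) (\<phi> \<circ> proj1)"
    and P: "real_of_ereal (ext_pressure I A G \<Psi> \<phi>) = P"
  shows "\<exists>n. ennreal b < mass (words_upto \<one> n)"
proof (rule ccontr)
  assume "\<not> ?thesis"
  then have le: "mass (words_upto \<one> n) \<le> ennreal b" for n by (simp add: not_less)
  obtain a h where ah: "(a, h) \<in> ext_alphabet I G"
    and inf: "(\<Sum>\<^sub>\<infinity>n\<in>{1..}. ennreal (exp (- real n * P)) *
       partition_fun (ext_alphabet I G) (ext_trans A G \<Psi>) (\<phi> \<circ> proj1) (a, h) n) = \<infinity>"
    using rec P unfolding recurrent_def ext_pressure_def by auto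
  have h: "h \<in> carrier G" using ah by (auto simp: ext_alphabet_def)
  have "(\<Sum>\<^sub>\<infinity>n\<in>{1..}. ennreal (exp (- real n * P)) * periodic_sum {\<one>} a n) \<le> ennreal b"
  proof (rule infsum_ennreal_le)
    fix F :: "nat set" assume F: "finite F" "F \<subseteq> {1..}"
    have "ennreal (exp (- real n * P)) * periodic_sum {\<one>} a n \<le> mass {w \<in> words n. gval w = \<one>}"
      if "n \<in> F" for n
    proof -
      have "n \<ge> 1" using F that by auto
      then have "ennreal (exp (- real n * P)) * periodic_sum {\<one>} a n \<le> mass (loops {\<one>} a n)"
        by (rule periodic_sum_le_loops)
      also have "\<dots> \<le> mass {w \<in> words n. gval w = \<one>}" by (rule mass_mono) (auto simp: loops_def)
      finally show ?thesis .
    qed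
    then have "(\<Sum>n\<in>F. ennreal (exp (- real n * P)) * periodic_sum {\<one>} a n) \<le>
        (\<Sum>n\<in>F. mass {w \<in> words n. gval w = \<one>})" by (rule sum_mono)
    also have "\<dots> \<le> (\<Sum>n=1..Max F. mass {w \<in> words n. gval w = \<one>})"
      using F by (intro sum_mono2) auto
    also have "\<dots> \<le> ennreal b" using le[of "Max F"] by (simp add: mass_words_upto_sum)
    finally show "(\<Sum>n\<in>F. ennreal (exp (- real n * P)) * periodic_sum {\<one>} a n) \<le> ennreal b" .
  qed
  then show False using inf by (simp add: partition_fun_ext[OF h] top_unique)
qed

text \<open>
  The two pressures may be computed at different letters, so partition functions are not compared
  directly. Instead, any \<open>P'\<close> above the pressure of the base bounds the masses of all words, hence
  of those with value \<open>\<one>\<close>, when it is used as normalisation.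
\<close>

lemma ext_pressure_le: "ext_pressure I A G \<Psi> \<phi> \<le> gurevich_pressure I A \<phi>"
proof (rule ereal_le_real)
  fix P' assume P': "gurevich_pressure I A \<phi> \<le> ereal P'"
  interpret Q: group_extended_shift G I A \<Psi> \<phi> D P' ..
  obtain a where a: "a \<in> I" "growth_rate (periodic_sum (carrier G) a) \<le> ereal P'"
    using base_pressure_eq_growth_rate P' by metis
  obtain C where C: "C > 0" "\<And>n. n \<ge> 1 \<Longrightarrow> Q.mass {w \<in> words n. gval w \<in> carrier G} \<le> ennreal C"
    using Q.mass_words_bounded[OF a(1) _ _ _ a(2)] by auto
  have "Q.mass {w \<in> words n. gval w \<in> {\<one>}} \<le> ennreal C" if "n \<ge> 1" for n
    by (rule order_trans[OF Q.mass_mono C(2)[OF that]]) auto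
  then have "growth_rate (periodic_sum {\<one>} a) \<le> ereal P'" for a
    using Q.growth_rate_le_if_bounded C(1) by blast
  then show "ext_pressure I A G \<Psi> \<phi> \<le> ereal P'"
    using ext_pressure_eq_growth_rate by metis
qed

lemma ext_pressure_not_MInf: "ext_pressure I A G \<Psi> \<phi> \<noteq> - \<infinity>"
  using ext_pressure_eq_growth_rate growth_rate_not_MInf by metis

end

text \<open>
  From here on weights are normalised by the pressure of the extension.
\<close>

locale recurrent_extension = group_extended_shift G I A \<Psi> \<phi> D P
  for G :: "('g, 'm) monoid_scheme" (structure) and I :: "'a set" and A \<Psi> \<phi> D P +
  assumes ext_pressure: "ext_pressure I A G \<Psi> \<phi> = ereal P"
    and recurrent: "recurrent (ext_alphabet I G) (ext_trans A G \<Psi>) (\<phi> \<circ> proj1)"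
begin

lemma mass_returns_bounded: "\<exists>C>0. \<forall>n\<ge>1. mass {w \<in> words n. gval w = \<one>} \<le> ennreal C"
proof -
  obtain a where "a \<in> I" "growth_rate (periodic_sum {\<one>} a) \<le> ereal P"
    using ext_pressure_eq_growth_rate ext_pressure by (metis order_refl)
  then show ?thesis using mass_words_bounded[of a "{\<one>}"] by auto
qed

lemma mass_words_upto_finite:
  assumes g: "g \<in> carrier G"
  shows "mass (words_upto g n) < \<infinity>"
proof -
  obtain C where C: "\<And>n. n \<ge> 1 \<Longrightarrow> mass {w \<in> words n. gval w = \<one>} \<le> ennreal C"
    using mass_returns_bounded by blast
  have one: "mass (words_upto \<one> n) < \<infinity>" for n
  proof -
    have "mass {w \<in> words k. gval w = \<one>} < \<infinity>" if "k \<in> {1..n}" for k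
      using C[of k] that by (auto intro: order_le_less_trans)
    then show ?thesis by (auto simp: mass_words_upto_sum)
  qed
  obtain c l where c: "c > 0" "ennreal c * mass (words_upto g n) \<le> mass (words_upto \<one> (n + l))"
    using words_upto_comparable[OF g one_closed] by metis
  then have "ennreal c * mass (words_upto g n) < \<infinity>" using one order_le_less_trans by blast
  then show ?thesis using c(1) by (auto simp: ennreal_mult_less_top)
qed

section \<open>Comparison of returns and first visits\<close>

definition visits :: "'g \<Rightarrow> nat \<Rightarrow> real" where
  "visits g n = enn2real (mass (words_upto g n))"

lemma visits: "g \<in> carrier G \<Longrightarrow> mass (words_upto g n) = ennreal (visits g n)"
  using mass_words_upto_finite by (simp add: visits_def)

lemma visits_nonneg [simp]: "0 \<le> visits g n"
  by (simp add: visits_def)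

lemma visits_mono:
  assumes "g \<in> carrier G" "m \<le> n"
  shows "visits g m \<le> visits g n"
proof -
  have "mass (words_upto g m) \<le> mass (words_upto g n)"
    using assms by (intro mass_mono) (auto simp: words_upto_def)
  then show ?thesis using assms by (simp add: visits)
qed

lemma visits_at_top: "filterlim (visits \<one>) at_top sequentially"
  unfolding filterlim_at_top
proof
  fix b :: real
  obtain n where "ennreal b < mass (words_upto \<one> n)"
    using recurrent_imp_unbounded[OF recurrent] ext_pressure by auto
  then have "b < visits \<one> n" by (metis ennreal_leI linorder_not_le visits one_closed)
  then have "b \<le> visits \<one> m" if "m \<ge> n" for m
    using visits_mono[OF one_closed that] by linarith
  then show "eventually (\<lambda>n. b \<le> visits \<one> n) sequentially"
    by (auto simp: eventually_sequentially)
qed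

text \<open>
  The increments of \<open>visits \<one>\<close> are bounded and \<open>visits \<one>\<close> tends to infinity, so bounded shifts of the argument
  change it by a factor arbitrarily close to \<open>1\<close>; the factor \<open>2\<close> is enough.
\<close>

lemma visits_add_le: "eventually (\<lambda>n. visits \<one> (n + N) \<le> 2 * visits \<one> n) sequentially"
proof -
  obtain C where C: "C > 0" "\<And>n. n \<ge> 1 \<Longrightarrow> mass {w \<in> words n. gval w = \<one>} \<le> ennreal C"
    using mass_returns_bounded by blast
  have step: "visits \<one> (n + N) \<le> visits \<one> n + real N * C" for n
  proof (induction N)
    case (Suc N)
    have "ennreal (visits \<one> (Suc (n + N))) \<le> ennreal (visits \<one> (n + N)) + ennreal C"
      using mass_words_upto_Suc[of \<one> "n + N"] C(2)[of "Suc (n + N)"] by (simp add: visits add_left_mono)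
    then have "visits \<one> (Suc (n + N)) \<le> visits \<one> (n + N) + C"
      using C(1) by (simp add: ennreal_plus[symmetric] del: ennreal_plus)
    then show ?case using Suc by (simp add: algebra_simps)
  qed simp
  have "eventually (\<lambda>n. real N * C \<le> visits \<one> n) sequentially"
    using visits_at_top by (simp add: filterlim_at_top)
  then show ?thesis
  proof eventually_elim
    case (elim n)
    then show ?case using step[of n] by linarith
  qed
qed

lemma visits_diff_ge: "eventually (\<lambda>n. N \<le> n \<and> visits \<one> n \<le> 2 * visits \<one> (n - N)) sequentially"
proof -
  have "eventually (\<lambda>n. visits \<one> (n - N + N) \<le> 2 * visits \<one> (n - N)) sequentially"
    using visits_add_le[of N] filterlim_minus_const_nat_at_top[of N] by (rule eventually_compose_filterlim)
  then show ?thesis using eventually_ge_at_top[of N] by eventually_elim simp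
qed

lemma eventually_visits_ge: "eventually (\<lambda>n. b \<le> visits \<one> n) sequentially"
  using visits_at_top by (simp add: filterlim_at_top)

lemma visits_le_visits_one:
  assumes g: "g \<in> carrier G"
  shows "\<exists>C>0. \<forall>N. eventually (\<lambda>n. visits g (n + N) \<le> C * visits \<one> n) sequentially"
proof -
  obtain c l where c: "c > 0"
    "\<And>n. ennreal c * mass (words_upto g n) \<le> mass (words_upto \<one> (n + l))"
    using words_upto_comparable[OF g one_closed] by blast
  have le: "c * visits g n \<le> visits \<one> (n + l)" for n
    using c(2)[of n] c(1) g by (simp add: visits ennreal_mult[symmetric])
  have "eventually (\<lambda>n. visits g (n + N) \<le> 2 / c * visits \<one> n) sequentially" for N
    using visits_add_le[of "N + l"]
  proof eventually_elim
    case (elim n)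
    have "c * visits g (n + N) \<le> 2 * visits \<one> n" using le[of "n + N"] elim by (simp add: add.assoc)
    then show ?case using c(1) by (simp add: field_simps)
  qed
  then show ?thesis using c(1) by (intro exI[of _ "2 / c"]) auto
qed

text \<open>
  If the words of \<open>X\<close> can be followed by arbitrary returns to \<open>\<one>\<close> to give words of one fixed value \<open>g\<close>, then
  the mass of \<open>X\<close> times \<open>visits \<one> n\<close> is at most a multiple of \<open>visits \<one> n\<close>. This applies to the
  first-visit words and to the words avoiding \<open>g\<close>.
\<close>

lemma mass_finite_if_extendable_by_returns:
  assumes g: "g \<in> carrier G" and c: "c > 0"
    and le: "\<And>N n. ennreal c * (mass {w \<in> X. length w \<le> N} * mass (words_upto \<one> n)) \<le>
      mass (words_upto g (N + n + l))"
  shows "mass X < \<infinity>"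
proof -
  obtain C where C: "C > 0"
    "\<And>N. eventually (\<lambda>n. visits g (n + N) \<le> C * visits \<one> n) sequentially"
    using visits_le_visits_one[OF g] by blast
  have "mass {w \<in> X. length w \<le> N} \<le> ennreal (C / c)" for N
  proof -
    have "eventually (\<lambda>n. visits g (n + (N + l)) \<le> C * visits \<one> n \<and> 1 \<le> visits \<one> n) sequentially"
      using C(2) eventually_visits_ge by (rule eventually_conj)
    then obtain n where n: "visits g (n + (N + l)) \<le> C * visits \<one> n" "1 \<le> visits \<one> n"
      by (auto simp: eventually_sequentially)
    have "ennreal (visits \<one> n * c) * mass {w \<in> X. length w \<le> N} \<le> ennreal (visits g (n + (N + l)))"
      using le[of N n] c g by (simp add: visits ennreal_mult mult_ac add_ac)
    also have "\<dots> \<le> ennreal (C * visits \<one> n)" using n by (intro ennreal_leI)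
    also have "\<dots> = ennreal (visits \<one> n * c) * ennreal (C / c)"
      using c C(1) n by (simp add: ennreal_mult[symmetric] mult.commute)
    finally show ?thesis using c n by (subst (asm) ennreal_mult_le_mult_iff) auto
  qed
  then have "mass X \<le> ennreal (C / c)" by (rule mass_le_if_bounded_length)
  then show ?thesis by (rule order_le_less_trans) simp
qed

text \<open>
  A constant for gluing with value \<open>\<one>\<close>, fixed once and for all because it must be the same for all group elements.
\<close>

definition glue_const :: real where "glue_const = (SOME c. \<exists>l. glues \<one> c l)"

lemma glue_const: "glue_const > 0" "\<exists>l. glues \<one> glue_const l"
proof -
  show "\<exists>l. glues \<one> glue_const l" unfolding glue_const_def by (rule someI_ex) (rule gluing[OF one_closed])
  then show "glue_const > 0" by (auto simp: glues_def)
qed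

definition hit_mass :: "'g \<Rightarrow> real" where
  "hit_mass g = enn2real (mass (hits g))"

lemma hit_mass: "g \<in> carrier G \<Longrightarrow> mass (hits g) = ennreal (hit_mass g)"
proof -
  assume g: "g \<in> carrier G"
  obtain l where l: "glues \<one> glue_const l" using glue_const by blast
  have "mass (hits g) < \<infinity>"
    using hits_times_words_upto_le[OF l g one_closed] g
    by (intro mass_finite_if_extendable_by_returns[OF g glue_const(1)]) (simp add: hits_upto_def)
  then show ?thesis by (simp add: hit_mass_def)
qed

lemma hit_mass_nonneg [simp]: "0 \<le> hit_mass g"
  by (simp add: hit_mass_def)

lemma avoiding_finite:
  assumes g: "g \<in> carrier G"
  shows "mass (avoiding g) < \<infinity>"
proof -
  obtain c l where "c > 0" and le: "\<And>N n. ennreal c *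
      (mass {w \<in> avoiding g. length w \<le> N} * mass (words_upto \<one> n)) \<le> mass (words_upto g (N + n + l))"
    using avoiding_times_words_upto_le[OF g] by blast
  show ?thesis by (rule mass_finite_if_extendable_by_returns[OF g \<open>c > 0\<close> le])
qed

lemma visits_le_hit_mass:
  assumes g: "g \<in> carrier G"
  shows "eventually (\<lambda>n. visits g n \<le> 2 * hit_mass g * visits \<one> n) sequentially"
  using eventually_visits_ge[of 1]
proof eventually_elim
  case (elim n)
  have "ennreal (visits g n) \<le> ennreal (hit_mass g) * (1 + ennreal (visits \<one> n))"
    using mass_words_upto_le[OF g, of n] g by (simp add: visits hit_mass)
  also have "\<dots> = ennreal (hit_mass g * (1 + visits \<one> n))"
    by (simp add: ennreal_mult ennreal_plus)
  finally have "visits g n \<le> hit_mass g * (1 + visits \<one> n)" by simp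
  also have "\<dots> \<le> hit_mass g * (2 * visits \<one> n)" using elim by (intro mult_left_mono) auto
  finally show ?case by simp
qed

text \<open>
  First visits within a bounded time \<open>N\<close> already carry half of \<open>hit_mass g\<close>. They take up only a bounded part
  of the length \<open>n\<close>, so the returns that follow still have half of the mass \<open>visits \<one> n\<close>.
\<close>

lemma hit_mass_le_visits:
  assumes g: "g \<in> carrier G"
  shows "eventually (\<lambda>n. glue_const / 4 * hit_mass g * visits \<one> n \<le> visits g n) sequentially"
proof (cases "hit_mass g = 0")
  case False
  then have pos: "hit_mass g > 0" using hit_mass_nonneg[of g] by linarith
  obtain l where l: "glues \<one> glue_const l" using glue_const by blast
  have "\<exists>N. ennreal (hit_mass g / 2) < mass (hits_upto g N)"
  proof (rule ccontr)
    assume "\<not> ?thesis"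
    then have "mass {w \<in> hits g. length w \<le> N} \<le> ennreal (hit_mass g / 2)" for N
      by (simp add: hits_upto_def not_less)
    then have "mass (hits g) \<le> ennreal (hit_mass g / 2)" by (rule mass_le_if_bounded_length)
    then show False using pos by (simp add: hit_mass[OF g])
  qed
  then obtain N where N: "ennreal (hit_mass g / 2) \<le> mass (hits_upto g N)" by (auto dest: less_imp_le)
  show ?thesis using visits_diff_ge[of "N + l"]
  proof eventually_elim
    case (elim n)
    let ?m = "n - (N + l)"
    have "ennreal glue_const * (ennreal (hit_mass g / 2) * ennreal (visits \<one> ?m)) \<le>
        ennreal glue_const * (mass (hits_upto g N) * mass (words_upto \<one> ?m))"
      using N by (intro mult_left_mono mult_mono) (auto simp: visits)
    also have "\<dots> \<le> mass (words_upto (g \<otimes> \<one>) (N + ?m + l))"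
      by (rule hits_times_words_upto_le[OF l g one_closed])
    also have "\<dots> = ennreal (visits g n)" using elim g by (simp add: visits)
    finally have "glue_const * (hit_mass g / 2 * visits \<one> ?m) \<le> visits g n"
      using glue_const(1) by (simp add: ennreal_mult[symmetric])
    moreover have "glue_const / 4 * hit_mass g * visits \<one> n \<le> glue_const / 4 * hit_mass g * (2 * visits \<one> ?m)"
      using elim glue_const(1) by (intro mult_left_mono) auto
    ultimately show ?case by simp
  qed
qed simp

text \<open>
  Recurrence in the form: passing through \<open>g\<close> and coming back to \<open>\<one>\<close> is almost certain. In the decomposition of the
  returns to \<open>\<one>\<close> by their first visit to \<open>g\<close> the part avoiding \<open>g\<close> stays bounded, and the other part is at most
  \<open>hit_mass g * (1 + 2 * hit_mass (inv g) * visits \<one> n)\<close>; dividing by \<open>visits \<one> n\<close> gives even \<open>1/2\<close> in the limit.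
\<close>

lemma hit_mass_inverse:
  assumes g: "g \<in> carrier G"
  shows "1 / 4 \<le> hit_mass g * hit_mass (inv g)"
proof (rule ccontr)
  assume "\<not> ?thesis"
  then have small: "hit_mass g * hit_mass (inv g) < 1 / 4" by simp
  define a where "a = enn2real (mass (avoiding g))"
  have a: "mass (avoiding g) = ennreal a" "a \<ge> 0" using avoiding_finite[OF g] by (auto simp: a_def)
  have "eventually (\<lambda>n. visits (inv g) n \<le> 2 * hit_mass (inv g) * visits \<one> n \<and>
      2 * (a + hit_mass g) + 1 \<le> visits \<one> n) sequentially"
    using visits_le_hit_mass[OF inv_closed[OF g]] eventually_visits_ge by (rule eventually_conj)
  then obtain n where n: "visits (inv g) n \<le> 2 * hit_mass (inv g) * visits \<one> n"
      "2 * (a + hit_mass g) + 1 \<le> visits \<one> n" by (auto simp: eventually_sequentially)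
  have "ennreal (visits \<one> n) \<le> ennreal a + ennreal (hit_mass g) * (1 + ennreal (visits (inv g) n))"
    using mass_returns_le[OF g, of n] g by (simp add: visits hit_mass a)
  also have "\<dots> = ennreal (a + hit_mass g * (1 + visits (inv g) n))"
    using a(2) by (simp add: ennreal_mult ennreal_plus)
  finally have "visits \<one> n \<le> a + hit_mass g * (1 + visits (inv g) n)"
    using a(2) by (subst (asm) ennreal_le_iff) auto
  also have "\<dots> \<le> a + hit_mass g * (1 + 2 * hit_mass (inv g) * visits \<one> n)"
    using n by (intro add_left_mono mult_left_mono) auto
  also have "\<dots> = a + hit_mass g + 2 * (hit_mass g * hit_mass (inv g)) * visits \<one> n"
    by (simp add: algebra_simps)
  also have "\<dots> \<le> a + hit_mass g + 2 * (1 / 4) * visits \<one> n"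
    using small by (intro add_left_mono mult_right_mono) auto
  finally show False using n(2) by simp
qed

lemma hit_mass_pos: "g \<in> carrier G \<Longrightarrow> 0 < hit_mass g"
  using hit_mass_inverse[of g] by (cases "hit_mass g = 0") (auto simp: order_less_le)

section \<open>Symmetry on average and equality of pressures\<close>

lemma symmetric_on_average_iff:
  "symmetric_on_average I A G \<Psi> \<phi> \<longleftrightarrow>
     (SUP g\<in>carrier G. limsup (\<lambda>n. ennreal (visits g n) / ennreal (visits (inv g) n))) < \<infinity>"
  unfolding symmetric_on_average_def Let_def ext_pressure real_of_ereal.simps weighted_sum_eq_mass
  by (simp add: visits cong: SUP_cong)

text \<open>
  By the two-sided comparison of \<open>visits g\<close> with \<open>hit_mass g * visits \<one>\<close>, symmetry bounds \<open>hit_mass g\<close> by a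
  multiple of \<open>hit_mass (inv g)\<close>, uniformly in \<open>g\<close>. Since the product of the two is at least \<open>1/4\<close>,
  neither can be small.
\<close>

lemma symmetric_imp_hit_mass_bounded_below:
  assumes "symmetric_on_average I A G \<Psi> \<phi>"
  shows "\<exists>\<kappa>>0. \<forall>g\<in>carrier G. \<kappa> \<le> hit_mass g"
proof -
  let ?q = "\<lambda>g n. ennreal (visits g n) / ennreal (visits (inv g) n)"
  have "(SUP g\<in>carrier G. limsup (?q g)) < \<infinity>" using assms by (simp add: symmetric_on_average_iff)
  then obtain M0 where M0: "M0 \<ge> 0" "(SUP g\<in>carrier G. limsup (?q g)) = ennreal M0"
    by (cases "SUP g\<in>carrier G. limsup (?q g)") auto
  define M where "M = M0 + 1"
  have M: "M > 0" "ennreal M0 < ennreal M" using M0(1) by (auto simp: M_def ennreal_less_iff)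
  have compare: "hit_mass g \<le> 8 * M / glue_const * hit_mass (inv g)" if g: "g \<in> carrier G" for g
  proof -
    have "limsup (?q g) < ennreal M"
      using SUP_upper[OF g, of "\<lambda>g. limsup (?q g)"] M0 M by simp
    then have "eventually (\<lambda>n. ?q g n < ennreal M) sequentially" by (rule Limsup_lessD)
    then have "eventually (\<lambda>n. ?q g n < ennreal M \<and> glue_const / 4 * hit_mass g * visits \<one> n \<le> visits g n \<and>
        glue_const / 4 * hit_mass (inv g) * visits \<one> n \<le> visits (inv g) n \<and>
        visits (inv g) n \<le> 2 * hit_mass (inv g) * visits \<one> n \<and> 1 \<le> visits \<one> n) sequentially"
      by (intro eventually_conj hit_mass_le_visits visits_le_hit_mass eventually_visits_ge g inv_closed)
    then obtain n where n: "?q g n < ennreal M" "glue_const / 4 * hit_mass g * visits \<one> n \<le> visits g n"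
        "glue_const / 4 * hit_mass (inv g) * visits \<one> n \<le> visits (inv g) n"
        "visits (inv g) n \<le> 2 * hit_mass (inv g) * visits \<one> n" "1 \<le> visits \<one> n"
      by (auto simp: eventually_sequentially)
    have "0 < glue_const / 4 * hit_mass (inv g) * visits \<one> n"
      using glue_const(1) hit_mass_pos[OF inv_closed[OF g]] n(5) by simp
    then have pos: "0 < visits (inv g) n" using n(3) by linarith
    then have "visits g n / visits (inv g) n \<le> M"
      using n(1) M(1) by (simp add: divide_ennreal ennreal_less_iff less_imp_le)
    then have "visits g n \<le> M * visits (inv g) n" using pos by (simp add: field_simps)
    also have "\<dots> \<le> M * (2 * hit_mass (inv g) * visits \<one> n)" using n(4) M(1) by (intro mult_left_mono) auto
    finally have "glue_const / 4 * hit_mass g * visits \<one> n \<le> 2 * M * hit_mass (inv g) * visits \<one> n"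
      using n(2) by simp
    then have "glue_const / 4 * hit_mass g \<le> 2 * M * hit_mass (inv g)"
      using n(5) by (simp add: mult_le_cancel_right)
    then show ?thesis using glue_const(1) by (simp add: field_simps)
  qed
  define \<kappa> where "\<kappa> = sqrt (glue_const / (32 * M))"
  have "\<kappa> \<le> hit_mass g" if g: "g \<in> carrier G" for g
  proof -
    have "1 / 4 \<le> hit_mass (inv g) * hit_mass g"
      using hit_mass_inverse[OF g] by (simp add: mult.commute)
    also have "\<dots> \<le> 8 * M / glue_const * hit_mass g * hit_mass g"
      using compare[OF inv_closed[OF g]] g by (intro mult_right_mono) auto
    finally have "glue_const / (32 * M) \<le> (hit_mass g)\<^sup>2"
      using glue_const(1) M(1) by (simp add: field_simps power2_eq_square)
    then show ?thesis unfolding \<kappa>_def by (intro real_le_lsqrt) (use glue_const(1) M(1) in auto)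
  qed
  moreover have "\<kappa> > 0" using glue_const(1) M(1) by (simp add: \<kappa>_def)
  ultimately show ?thesis by blast
qed

text \<open>
  Returns to \<open>\<one>\<close> built from a word of length \<open>n\<close> and a long word of inverse value have mass at least a constant
  times \<open>mass (words n) * visits \<one> m\<close>, and at most \<open>2 * visits \<one> m\<close> for large \<open>m\<close>. As \<open>m\<close> must
  be large for all occurring values at once, finite sets of words are treated first.
\<close>

lemma hit_mass_bounded_below_imp_mass_bounded:
  assumes \<kappa>: "\<kappa> > 0" "\<And>g. g \<in> carrier G \<Longrightarrow> \<kappa> \<le> hit_mass g"
  shows "\<exists>C>0. \<forall>n\<ge>1. mass (words n) \<le> ennreal C"
proof -
  obtain l where l: "glues \<one> glue_const l" using glue_const by blast
  define \<kappa>' where "\<kappa>' = glue_const / 4 * \<kappa>"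
  have \<kappa>': "\<kappa>' > 0" using glue_const(1) \<kappa>(1) by (simp add: \<kappa>'_def)
  have low: "eventually (\<lambda>m. \<kappa>' * visits \<one> m \<le> visits g m) sequentially" if g: "g \<in> carrier G" for g
    using hit_mass_le_visits[OF g]
  proof eventually_elim
    case (elim m)
    have "\<kappa>' * visits \<one> m \<le> glue_const / 4 * hit_mass g * visits \<one> m"
      unfolding \<kappa>'_def using glue_const(1) \<kappa>(2)[OF g] by (intro mult_right_mono mult_left_mono) auto
    then show ?case using elim by linarith
  qed
  have "mass (words n) \<le> ennreal (2 / (glue_const * \<kappa>'))" if n: "n \<ge> 1" for n
    unfolding mass_def
  proof (rule infsum_ennreal_le)
    fix X assume X: "finite X" "X \<subseteq> words n"
    have val: "inv (gval x) \<in> carrier G" if "x \<in> X" for x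
      using X that by (auto simp: adm_words_of_length_iff gval_adm_closed)
    have "eventually (\<lambda>m. \<forall>x\<in>X. \<kappa>' * visits \<one> m \<le> visits (inv (gval x)) m) sequentially"
      using X(1) low val by (intro eventually_ball_finite) auto
    then have "eventually (\<lambda>m. (\<forall>x\<in>X. \<kappa>' * visits \<one> m \<le> visits (inv (gval x)) m) \<and>
        visits \<one> (m + (n + l)) \<le> 2 * visits \<one> m \<and> 1 \<le> visits \<one> m) sequentially"
      by (intro eventually_conj visits_add_le eventually_visits_ge)
    then obtain m where m: "\<And>x. x \<in> X \<Longrightarrow> \<kappa>' * visits \<one> m \<le> visits (inv (gval x)) m"
        "visits \<one> (m + (n + l)) \<le> 2 * visits \<one> m" "1 \<le> visits \<one> m"
      by (auto simp: eventually_sequentially)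
    have "ennreal (glue_const * (\<kappa>' * visits \<one> m)) * (\<Sum>x\<in>X. ennreal (wt x)) =
        ennreal glue_const * (\<Sum>x\<in>X. ennreal (wt x) * ennreal (\<kappa>' * visits \<one> m))"
      unfolding sum_distrib_right[symmetric] using glue_const(1) \<kappa>'
      by (subst ennreal_mult) (auto simp only: mult_ac visits_nonneg mult_nonneg_nonneg less_imp_le)
    also have "\<dots> \<le> ennreal glue_const * (\<Sum>x\<in>X. ennreal (wt x) * mass (words_upto (inv (gval x)) m))"
      using m(1) val by (intro mult_left_mono sum_mono) (auto simp: visits)
    also have "\<dots> \<le> mass (words_upto \<one> (n + m + l))"
      using words_times_words_upto_le[OF l X(2) n, of m] X(1) by simp
    also have "\<dots> \<le> ennreal (2 * visits \<one> m)"
      using m(2) by (simp add: visits add_ac)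
    also have "\<dots> = ennreal (glue_const * (\<kappa>' * visits \<one> m)) * ennreal (2 / (glue_const * \<kappa>'))"
      using glue_const(1) \<kappa>' m(3) by (simp add: ennreal_mult[symmetric])
    finally show "(\<Sum>x\<in>X. ennreal (wt x)) \<le> ennreal (2 / (glue_const * \<kappa>'))"
      using glue_const(1) \<kappa>' m(3) by (subst (asm) ennreal_mult_le_mult_iff) auto
  qed
  then show ?thesis using glue_const(1) \<kappa>' by (intro exI[of _ "2 / (glue_const * \<kappa>')"]) auto
qed

lemma words_with_value_in_carrier: "{w \<in> words n. gval w \<in> carrier G} = words n"
  by (auto simp: adm_words_of_length_iff gval_adm_closed)

lemma symmetric_imp_pressure_eq:
  assumes "symmetric_on_average I A G \<Psi> \<phi>"
  shows "ext_pressure I A G \<Psi> \<phi> = gurevich_pressure I A \<phi>"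
proof -
  obtain C where "C > 0" "\<And>n. n \<ge> 1 \<Longrightarrow> mass (words n) \<le> ennreal C"
    using symmetric_imp_hit_mass_bounded_below[OF assms] hit_mass_bounded_below_imp_mass_bounded by metis
  then have "growth_rate (periodic_sum (carrier G) a) \<le> ereal P" for a
    by (intro growth_rate_le_if_bounded[where C = C]) (auto simp: words_with_value_in_carrier)
  then have "gurevich_pressure I A \<phi> \<le> ereal P" using base_pressure_eq_growth_rate by metis
  then show ?thesis using ext_pressure_le ext_pressure by simp
qed

text \<open>
  Masses of words of a given length are submultiplicative. If one of them were less than \<open>1\<close>, they would
  decay exponentially and be summable, contradicting the divergence of \<open>visits \<one>\<close>. Summability is read off from
  \<open>B m \<le> B n + s n * B m\<close> for the partial sums \<open>B\<close>.
\<close>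

lemma mass_words_ge_1:
  assumes finite: "\<And>m. m \<ge> 1 \<Longrightarrow> mass (words m) < \<infinity>" and n: "n \<ge> 1"
  shows "1 \<le> mass (words n)"
proof (rule ccontr)
  assume "\<not> ?thesis"
  then have lt: "mass (words n) < 1" by simp
  define s where "s = (\<lambda>m. enn2real (mass (words m)))"
  have s: "mass (words m) = ennreal (s m)" if "m \<ge> 1" for m
    using finite[OF that] by (simp add: s_def)
  have s_nonneg: "0 \<le> s m" for m by (simp add: s_def)
  have s_n: "s n < 1" using lt s[OF n] s_nonneg[of n] by (simp add: ennreal_less_one_iff)
  have submult: "s (m + n) \<le> s m * s n" if m: "m \<ge> 1" for m
  proof -
    have "mass (words (m + n)) \<le> mass (words m) * mass (words n)"
    proof (rule mass_split)
      fix w assume w: "w \<in> words (m + n)"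
      then have "take m w \<in> words m" "drop m w \<in> words n"
        using admissible_append[of I A "take m w" "drop m w"]
        by (auto simp: adm_words_of_length_iff)
      then show "\<exists>u\<in>words m. \<exists>v\<in>words n. w = u @ v" by (metis append_take_drop_id)
    qed (simp add: adm_words_of_length_iff)
    then show ?thesis using m n s_nonneg by (simp add: s ennreal_mult[symmetric])
  qed
  define B where "B = (\<lambda>m. \<Sum>k=1..m. s k)"
  have "B m \<le> B n / (1 - s n)" for m
  proof -
    have "B m \<le> B (m + n)" unfolding B_def using s_nonneg by (intro sum_mono2) auto
    also have "B (m + n) = B n + (\<Sum>k=1..m. s (k + n))"
    proof -
      have "{1..m + n} = {1..n} \<union> {1 + n..m + n}" using n by auto
      then have "B (m + n) = B n + (\<Sum>k=1+n..m+n. s k)"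
        unfolding B_def by (simp only:) (rule sum.union_disjoint; auto)
      then show ?thesis by (simp only: sum.shift_bounds_cl_nat_ivl)
    qed
    also have "(\<Sum>k=1..m. s (k + n)) \<le> (\<Sum>k=1..m. s k * s n)"
      using submult by (intro sum_mono) auto
    also have "\<dots> = B m * s n" by (simp add: B_def sum_distrib_right)
    finally have "B m * (1 - s n) \<le> B n" by (simp add: algebra_simps)
    then show ?thesis using s_n by (simp add: field_simps)
  qed
  moreover have "visits \<one> m \<le> B m" for m
  proof -
    have "ennreal (visits \<one> m) \<le> (\<Sum>k=1..m. mass (words k))"
      unfolding visits[OF one_closed, symmetric] mass_words_upto_sum by (intro sum_mono mass_mono) auto
    also have "\<dots> = ennreal (B m)"
      unfolding B_def using s_nonneg by (subst sum_ennreal[symmetric]) (auto intro!: sum.cong simp: s)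
    finally show ?thesis using s_nonneg by (simp add: B_def sum_nonneg)
  qed
  ultimately have le: "visits \<one> m \<le> B n / (1 - s n)" for m using order_trans by blast
  obtain m where "B n / (1 - s n) + 1 \<le> visits \<one> m"
    using eventually_visits_ge[of "B n / (1 - s n) + 1"] by (auto simp: eventually_sequentially)
  then show False using le[of m] by linarith
qed

text \<open>
  Each first-visit word extends to words of a common length, with extensions of total mass at least
  \<open>1\<close>; distinct first-visit words have distinct extensions, and all of them together have bounded
  mass.
\<close>

lemma pressure_eq_imp_hit_mass_bounded:
  assumes eq: "ext_pressure I A G \<Psi> \<phi> = gurevich_pressure I A \<phi>"
  shows "\<exists>K>0. \<forall>g\<in>carrier G. hit_mass g \<le> K"
proof -
  obtain a where "a \<in> I" "growth_rate (periodic_sum (carrier G) a) \<le> ereal P"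
    using base_pressure_eq_growth_rate ext_pressure eq by (metis order_refl)
  then obtain C where C: "C > 0" "\<And>n. n \<ge> 1 \<Longrightarrow> mass (words n) \<le> ennreal C"
    using mass_words_bounded[of a "carrier G"] by (auto simp: words_with_value_in_carrier)
  have finite: "mass (words n) < \<infinity>" if "n \<ge> 1" for n
    using C(2)[OF that] by (rule order_le_less_trans) simp
  obtain l where l: "glues \<one> glue_const l" using glue_const by blast
  have "hit_mass g \<le> C / glue_const" if g: "g \<in> carrier G" for g
  proof -
    have "mass {w \<in> hits g. length w \<le> N} \<le> ennreal (C / glue_const)" for N
    proof -
      have "mass (hits_upto g N) \<le> (\<Sum>\<^sub>\<infinity>x\<in>hits_upto g N. ennreal (wt x) * mass (words (N + 1 - length x)))"
        unfolding mass_def[of "hits_upto g N"]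
      proof (intro infsum_mono nonneg_summable_on_complete)
        fix x assume "x \<in> hits_upto g N"
        then have "1 \<le> mass (words (N + 1 - length x))"
          by (intro mass_words_ge_1 finite) (auto simp: hits_upto_def)
        then show "ennreal (wt x) \<le> ennreal (wt x) * mass (words (N + 1 - length x))"
          using mult_left_mono[of 1 _ "ennreal (wt x)"] by simp
      qed auto
      then have "ennreal glue_const * mass (hits_upto g N) \<le>
          ennreal glue_const * (\<Sum>\<^sub>\<infinity>x\<in>hits_upto g N. ennreal (wt x) * mass (words (N + 1 - length x)))"
        by (intro mult_left_mono) auto
      also have "\<dots> \<le> mass (words (N + 1 + l))" by (rule hits_times_words_le[OF l])
      also have "\<dots> \<le> ennreal C" by (intro C) simp
      also have "\<dots> = ennreal glue_const * ennreal (C / glue_const)" using glue_const(1) C(1) by (simp add: ennreal_mult[symmetric])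
      finally show ?thesis using glue_const(1) by (subst (asm) ennreal_mult_le_mult_iff) (auto simp: hits_upto_def)
    qed
    then have "mass (hits g) \<le> ennreal (C / glue_const)" by (rule mass_le_if_bounded_length)
    then show ?thesis using glue_const(1) C(1) g by (simp add: hit_mass)
  qed
  then show ?thesis using glue_const(1) C(1) by (intro exI[of _ "C / glue_const"]) auto
qed

text \<open>
  An upper bound \<open>K\<close> of \<open>hit_mass\<close> entails the lower bound \<open>1 / (4 * K)\<close>, so all ratios are eventually at
  most \<open>32 * K\<^sup>2 / glue_const\<close>.
\<close>

lemma pressure_eq_imp_symmetric:
  assumes eq: "ext_pressure I A G \<Psi> \<phi> = gurevich_pressure I A \<phi>"
  shows "symmetric_on_average I A G \<Psi> \<phi>"
proof -
  obtain K where K: "K > 0" "\<And>g. g \<in> carrier G \<Longrightarrow> hit_mass g \<le> K"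
    using pressure_eq_imp_hit_mass_bounded[OF eq] by blast
  have "limsup (\<lambda>n. ennreal (visits g n) / ennreal (visits (inv g) n)) \<le> ennreal (32 * K\<^sup>2 / glue_const)"
    if g: "g \<in> carrier G" for g
  proof (rule Limsup_bounded)
    have "1 / 4 \<le> K * hit_mass (inv g)"
      using hit_mass_inverse[OF g] K(2)[OF g] mult_right_mono[of "hit_mass g" K "hit_mass (inv g)"]
      by simp
    then have low: "1 / (4 * K) \<le> hit_mass (inv g)" using K(1) by (simp add: field_simps)
    have "eventually (\<lambda>n. visits g n \<le> 2 * hit_mass g * visits \<one> n \<and>
        glue_const / 4 * hit_mass (inv g) * visits \<one> n \<le> visits (inv g) n \<and> 1 \<le> visits \<one> n) sequentially"
      by (intro eventually_conj hit_mass_le_visits visits_le_hit_mass eventually_visits_ge g inv_closed)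
    then show "eventually (\<lambda>n. ennreal (visits g n) / ennreal (visits (inv g) n) \<le>
        ennreal (32 * K\<^sup>2 / glue_const)) sequentially"
    proof eventually_elim
      case (elim n)
      have "2 * hit_mass g * visits \<one> n \<le> 2 * K * visits \<one> n"
        using K(2)[OF g] by (intro mult_right_mono) auto
      then have up: "visits g n \<le> 2 * K * visits \<one> n" using elim by linarith
      have "glue_const / 4 * (1 / (4 * K)) * visits \<one> n \<le> glue_const / 4 * hit_mass (inv g) * visits \<one> n"
        using low glue_const(1) by (intro mult_right_mono mult_left_mono) auto
      then have down: "glue_const / (16 * K) * visits \<one> n \<le> visits (inv g) n" using elim by simp
      have "0 < glue_const / (16 * K) * visits \<one> n" using elim glue_const(1) K(1) by simp
      then have pos: "0 < visits (inv g) n" using down by linarith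
      have "visits g n \<le> 32 * K\<^sup>2 / glue_const * (glue_const / (16 * K) * visits \<one> n)"
        using up glue_const(1) K(1) by (simp add: field_simps power2_eq_square)
      also have "\<dots> \<le> 32 * K\<^sup>2 / glue_const * visits (inv g) n"
        using down glue_const(1) by (intro mult_left_mono) auto
      finally have "visits g n / visits (inv g) n \<le> 32 * K\<^sup>2 / glue_const" using pos by (simp add: pos_divide_le_eq)
      then show ?case using pos by (simp add: divide_ennreal ennreal_leI)
    qed
  qed
  then have "(SUP g\<in>carrier G. limsup (\<lambda>n. ennreal (visits g n) / ennreal (visits (inv g) n))) \<le>
      ennreal (32 * K\<^sup>2 / glue_const)" by (rule SUP_least)
  then show ?thesis unfolding symmetric_on_average_iff by (rule order_le_less_trans) simp
qed

end

theorem proposition1p5: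
  fixes I :: "nat set" and A :: "nat \<Rightarrow> nat \<Rightarrow> bool"
    and G :: "('g, 'm) monoid_scheme" and \<Psi> :: "nat list \<Rightarrow> 'g"
    and \<phi> :: "(nat \<Rightarrow> nat) \<Rightarrow> real"
  assumes "finitely_primitive I A"
    and "group G" and "countable (carrier G)"
    and "\<Psi> \<in> hom (free_semigroup I) G"
    and "topologically_mixing (ext_alphabet I G) (ext_trans A G \<Psi>)"
    and "hoelder_continuous I A \<phi>"
    and "ext_pressure I A G \<Psi> \<phi> < \<infinity>"
    and "recurrent (ext_alphabet I G) (ext_trans A G \<Psi>) (\<phi> \<circ> proj1)"
  shows "symmetric_on_average I A G \<Psi> \<phi> \<longleftrightarrow>
         ext_pressure I A G \<Psi> \<phi> = gurevich_pressure I A \<phi>"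
proof -
  obtain D where D: "D \<ge> 0" "\<And>w x y. x \<in> cylinder I A w \<Longrightarrow> y \<in> cylinder I A w \<Longrightarrow>
      birkhoff_sum \<phi> (length w) x \<le> birkhoff_sum \<phi> (length w) y + D"
    using hoelder_bounded_distortion[OF assms(6)] by blast
  have "I \<noteq> {}" using assms(8) by (auto simp: recurrent_def ext_alphabet_def)
  then have shift: "group_extended_shift G I A \<Psi> \<phi> D"
    using assms D by (intro group_extended_shift.intro group_extended_shift_axioms.intro)
  define P where "P = real_of_ereal (ext_pressure I A G \<Psi> \<phi>)"
  have "ext_pressure I A G \<Psi> \<phi> = ereal P"
    using group_extended_shift.ext_pressure_not_MInf[OF shift] assms(7)
    by (cases "ext_pressure I A G \<Psi> \<phi>") (auto simp: P_def)
  then interpret recurrent_extension G I A \<Psi> \<phi> D P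
    using assms(8) shift by (intro recurrent_extension.intro recurrent_extension_axioms.intro)
  show ?thesis using symmetric_imp_pressure_eq pressure_eq_imp_symmetric by blast
qed

end
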